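(* Let $q$ be an odd prime power, $t\ge5$, and $s$ an integer with $1\le s\le 2t-1$ and $\gcd(s,2t)=1$. Let $(m,h)$ be an admissible pair for $(q,t,s)$. Let $\Sigma$ be a canonical subgeometry of $\mathrm{PG}(2t-1,q^{2t})$ and let $\sigma$ be a collineation of order $2t$ of $\mathrm{PG}(2t-1,q^{2t})$ fixing $\Sigma$ pointwise. Let $\Gamma$ be a $(2t-3)$-dimensional subspace and $\Lambda$ a line of $\mathrm{PG}(2t-1,q^{2t})$ with $\Gamma\cap\Sigma=\emptyset=\Gamma\cap\Lambda$, and suppose that the linear set $\mathrm{p}_{\Gamma,\Lambda}(\Sigma)$ is equivalent to $L_{\psi_{m,h,s}}$. Then $\mathrm{intn}_\sigma(\Gamma)\ge3$.
   Context: Trace and norm: $\mathrm{Tr}_{q^{2t}/q^t}(x)=x+x^{q^t}$, $\mathrm{N}_{q^{2t}/q^t}(x)=x^{q^t+1}$. Put $\mathscr{P}^+_s=\{w^{q^s+1}: w\in\ker\mathrm{Tr}_{q^{2t}/q^t}\}$ and $\mathscr{P}^-_s=\{w^{q^s-1}: w\in\ker\mathrm{Tr}_{q^{2t}/q^t}\}$ (subsets of $\mathbb{F}_{q^t}$). A pair $(m,h)\in\mathbb{F}_{q^t}^*\times\mathbb{F}_{q^{2t}}$ is called admissible for $(q,t,s)$ if one of the following holds: (i) [$t$ even, or $t$ odd and $q\equiv1\pmod4$] and $m\notin\mathscr{P}^+_s\cup\mathscr{P}^-_s$ and $\mathrm{N}_{q^{2t}/q^t}(h)=\pm1$; (ii)(a)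 $t$ odd, $q\equiv3\pmod4$, $m\in\mathscr{P}^+_s$ and $\mathrm{N}_{q^{2t}/q^t}(h)=-1$; (ii)(b) $t$ odd, $q\equiv3\pmod4$, $m\notin\mathscr{P}^+_s\cup\mathscr{P}^-_s$, $\mathrm{N}_{q^{2t}/q^t}(h)=1$ and $h^2\neq-1$. $\psi_{m,h,s}= m(X^{q^s}-h^{1-q^{s(t+1)}}X^{q^{s(t+1)}})+X^{q^{s(t-1)}}+h^{1-q^{s(2t-1)}}X^{q^{s(2t-1)}}$, viewed as an $\mathbb{F}_q$-linear map of $\mathbb{F}_{q^{2t}}$, and $L_{\psi_{m,h,s}}=\{\langle(x,\psi_{m,h,s}(x))\rangle_{\mathbb{F}_{q^{2t}}}:x\in\mathbb{F}_{q^{2t}}^*\}\subset\mathrm{PG}(1,q^{2t})$. For an $\mathbb{F}_q$-subspace $U$ of $\mathbb{F}_{q^n}^r$, $L_U=\{\langle u\rangle_{\mathbb{F}_{q^n}}:u\in U\setminus\{0\}\}$ is an $\mathbb{F}_q$-linear set of rank $\dim_{\mathbb{F}_q}U$. A canonical subgeometry of $\mathrm{PG}(r-1,q^n)$ is a linear set $L_U$ of rank $r$ that spans $\mathrm{PG}(r-1,q^n)$. Two linear sets of $\mathrm{PG}(r-1,q^n)$ are equivalent if some element of $\mathrm{P\Gamma L}(r,q^n)$ maps one to the other; here the line $\Lambda$ is identified with $\mathrm{PG}(1,q^{2t})$. $\mathrm{p}_{\Gamma,\Lambda}(\Sigma)=\{\langle\Gamma,P\rangle\cap\Lambda:P\in\Sigma\}$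 denotes the projection of $\Sigma$ from the vertex $\Gamma$ onto the axis $\Lambda$. For a non-empty $k$-dimensional (projective dimension) subspace $\Gamma$ of $\mathrm{PG}(n-1,q^n)$ and a collineation $\sigma$ fixing pointwise a canonical subgeometry, $\mathrm{intn}_\sigma(\Gamma)$ is the least positive integer $\gamma$ such that $\dim(\Gamma\cap\Gamma^\sigma\cap\cdots\cap\Gamma^{\sigma^\gamma})>k-2\gamma$. *)

theory Defs
  imports "HOL-Analysis.Analysis" "HOL-Number_Theory.Prime_Powers"
begin

text \<open>
  \<open>PG(r-1, F)\<close> is modelled on \<open>F ^ 'r\<close> with \<open>CARD('r) = r\<close>: a projective subspace is a vector
  subspace, a point is a one-dimensional vector subspace, the empty subspace is \<open>{0}\<close>.
  The field \<open>F\<close> is a type of class field and finite; its cardinality \<open>q ^ (2 * t)\<close> is an assumption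
  wherever it matters.
\<close>

definition points :: "('a::field ^ 'r) set set" where
  "points = {vec.span {v} | v. v \<noteq> 0}"

definition pdim :: "('a::field ^ 'r) set \<Rightarrow> int" where
  "pdim S = int (vec.dim S) - 1"

definition proj_subspace :: "int \<Rightarrow> ('a::field ^ 'r) set \<Rightarrow> bool" where
  "proj_subspace k S \<longleftrightarrow> vec.subspace S \<and> pdim S = k"

definition field_automorphism :: "('a::field \<Rightarrow> 'a) \<Rightarrow> bool" where
  "field_automorphism \<theta> \<longleftrightarrow> bij \<theta> \<and> (\<forall>a b. \<theta> (a + b) = \<theta> a + \<theta> b) \<and> (\<forall>a b. \<theta> (a * b) = \<theta> a * \<theta> b)"

definition semilinear :: "('a::field \<Rightarrow> 'a) \<Rightarrow> ('a ^ 'r \<Rightarrow> 'a ^ 'r) \<Rightarrow> bool" where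
  "semilinear \<theta> f \<longleftrightarrow> (\<forall>u v. f (u + v) = f u + f v) \<and> (\<forall>c v. f (c *s v) = \<theta> c *s f v)"

text \<open>
  An element of \<open>P\<Gamma>L(r, F)\<close> is a map on subspaces induced by a bijective semilinear map; its
  values on sets that are not subspaces are irrelevant. The collineations of \<open>PG(r-1, F)\<close> are
  understood to be these maps.
\<close>

definition PGammaL :: "(('a::field ^ 'r) set \<Rightarrow> ('a ^ 'r) set) set" where
  "PGammaL = {\<phi>. \<exists>\<theta> f. field_automorphism \<theta> \<and> semilinear \<theta> f \<and> bij f \<and>
                  (\<forall>S. vec.subspace S \<longrightarrow> \<phi> S = f ` S)}"

definition collineation_order :: "(('a::field ^ 'r) set \<Rightarrow> ('a ^ 'r) set) \<Rightarrow> nat" where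
  "collineation_order \<phi> = (LEAST k. k > 0 \<and> (\<forall>P\<in>points. (\<phi> ^^ k) P = P))"

definition pg_equivalent :: "('a::field ^ 'r) set set \<Rightarrow> ('a ^ 'r) set set \<Rightarrow> bool" where
  "pg_equivalent A B \<longleftrightarrow> (\<exists>\<phi>\<in>PGammaL. \<phi> ` A = B)"

definition projection ::
    "('a::field ^ 'r) set \<Rightarrow> ('a ^ 'r) set \<Rightarrow> ('a ^ 'r) set set \<Rightarrow> ('a ^ 'r) set set" where
  "projection \<Gamma> \<Lambda> \<Sigma> = {vec.span (\<Gamma> \<union> P) \<inter> \<Lambda> | P. P \<in> \<Sigma>}"

text \<open>
  An identification of the line \<open>\<Lambda>\<close> with \<open>PG(1, F)\<close>, given by homogeneous coordinates on \<open>\<Lambda>\<close>.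
  Only the restriction of \<open>\<iota>\<close> to \<open>\<Lambda>\<close> matters; every linear map on \<open>\<Lambda>\<close> extends to the whole space.
\<close>

definition line_coordinates :: "('a::field ^ 'r) set \<Rightarrow> ('a ^ 'r \<Rightarrow> 'a ^ 2) \<Rightarrow> bool" where
  "line_coordinates \<Lambda> \<iota> \<longleftrightarrow> Vector_Spaces.linear (*s) (*s) \<iota> \<and> bij_betw \<iota> \<Lambda> UNIV"

text \<open>
  The least \<open>\<gamma>\<close> exists since \<open>pdim \<Gamma> - 2 * \<gamma> < -1\<close> for large \<open>\<gamma>\<close>.
\<close>

definition intn :: "(('a::field ^ 'r) set \<Rightarrow> ('a ^ 'r) set) \<Rightarrow> ('a ^ 'r) set \<Rightarrow> nat" where
  "intn \<sigma> \<Gamma> = (LEAST \<gamma>. \<gamma> > 0 \<and> pdim (\<Inter>i\<in>{..\<gamma>}. (\<sigma> ^^ i) \<Gamma>) > pdim \<Gamma> - 2 * int \<gamma>)"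

text \<open>The subfield of order \<open>q\<close>, when \<open>F\<close> has order a power of \<open>q\<close>.\<close>

definition Fq :: "nat \<Rightarrow> 'a::field set" where
  "Fq q = {c. c ^ q = c}"

definition Fq_subspace :: "nat \<Rightarrow> ('a::field ^ 'r) set \<Rightarrow> bool" where
  "Fq_subspace q U \<longleftrightarrow> 0 \<in> U \<and> (\<forall>u\<in>U. \<forall>v\<in>U. u + v \<in> U) \<and> (\<forall>c\<in>Fq q. \<forall>u\<in>U. c *s u \<in> U)"

definition Fq_basis :: "nat \<Rightarrow> ('a::field ^ 'r) set \<Rightarrow> ('a ^ 'r) set \<Rightarrow> bool" where
  "Fq_basis q U B \<longleftrightarrow> finite B \<and>
     U = {\<Sum>b\<in>B. c b *s b | c. c ` B \<subseteq> Fq q} \<and>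
     (\<forall>c. c ` B \<subseteq> Fq q \<and> (\<Sum>b\<in>B. c b *s b) = 0 \<longrightarrow> (\<forall>b\<in>B. c b = 0))"

definition Fq_dim :: "nat \<Rightarrow> ('a::field ^ 'r) set \<Rightarrow> nat" where
  "Fq_dim q U = card (SOME B. Fq_basis q U B)"

definition linear_set :: "('a::field ^ 'r) set \<Rightarrow> ('a ^ 'r) set set" where
  "linear_set U = {vec.span {u} | u. u \<in> U \<and> u \<noteq> 0}"

definition canonical_subgeometry :: "nat \<Rightarrow> ('a::field ^ 'r) set set \<Rightarrow> bool" where
  "canonical_subgeometry q \<Sigma> \<longleftrightarrow>
     (\<exists>U. Fq_subspace q U \<and> Fq_dim q U = CARD('r) \<and> \<Sigma> = linear_set U \<and> vec.span (\<Union>\<Sigma>) = UNIV)"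

definition Tr :: "nat \<Rightarrow> nat \<Rightarrow> 'a::field \<Rightarrow> 'a" where
  "Tr q t x = x + x ^ (q ^ t)"

definition Nm :: "nat \<Rightarrow> nat \<Rightarrow> 'a::field \<Rightarrow> 'a" where
  "Nm q t x = x ^ (q ^ t + 1)"

definition P_plus :: "nat \<Rightarrow> nat \<Rightarrow> nat \<Rightarrow> 'a::field set" where
  "P_plus q t s = {w ^ (q ^ s + 1) | w. Tr q t w = 0}"

definition P_minus :: "nat \<Rightarrow> nat \<Rightarrow> nat \<Rightarrow> 'a::field set" where
  "P_minus q t s = {w ^ (q ^ s - 1) | w. Tr q t w = 0}"

definition admissible :: "nat \<Rightarrow> nat \<Rightarrow> nat \<Rightarrow> 'a::field \<Rightarrow> 'a \<Rightarrow> bool" where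
  "admissible q t s m h \<longleftrightarrow> m \<in> Fq (q ^ t) \<and> m \<noteq> 0 \<and>
    ((even t \<or> odd t \<and> q mod 4 = 1) \<and> m \<notin> P_plus q t s \<union> P_minus q t s \<and>
       (Nm q t h = 1 \<or> Nm q t h = -1)
     \<or> odd t \<and> q mod 4 = 3 \<and> m \<in> P_plus q t s \<and> Nm q t h = -1
     \<or> odd t \<and> q mod 4 = 3 \<and> m \<notin> P_plus q t s \<union> P_minus q t s \<and>
       Nm q t h = 1 \<and> h\<^sup>2 \<noteq> -1)"

text \<open>
  The exponents of \<open>h\<close> are negative integers, hence \<open>powi\<close>; admissibility forces \<open>h \<noteq> 0\<close>.
\<close>

definition psi :: "nat \<Rightarrow> nat \<Rightarrow> 'a::field \<Rightarrow> 'a \<Rightarrow> nat \<Rightarrow> 'a \<Rightarrow> 'a" where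
  "psi q t m h s x =
     m * (x ^ (q ^ s) - h powi (1 - int (q ^ (s * (t + 1)))) * x ^ (q ^ (s * (t + 1))))
     + x ^ (q ^ (s * (t - 1)))
     + h powi (1 - int (q ^ (s * (2 * t - 1)))) * x ^ (q ^ (s * (2 * t - 1)))"

definition L_psi :: "nat \<Rightarrow> nat \<Rightarrow> 'a::field \<Rightarrow> 'a \<Rightarrow> nat \<Rightarrow> ('a ^ 2) set set" where
  "L_psi q t m h s = linear_set {vector [x, psi q t m h s x] | x. True}"

end

theory Submission
  imports Defs "HOL-Number_Theory.Cong"
begin

text \<open>
  Let \<open>n = 2 * t\<close> and \<open>F = GF(q ^ n)\<close>. The vertex \<open>\<Gamma>\<close> is the common kernel of two linear functionals, and up to
  a scalar \<open>\<sigma>\<close> acts on the coordinates with respect to a basis of the subgeometry by a field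
  automorphism \<open>\<theta>\<close>, which is \<open>x \<mapsto> x ^ (q ^ r)\<close> with \<open>r\<close> prime to \<open>n\<close>. So the images of \<open>\<Gamma>\<close> under the
  powers of \<open>\<sigma>\<close> are cut out by the images of the two functionals under the powers of \<open>\<theta>\<close>, and the
  intersection number is at least \<open>3\<close> as soon as the six functionals obtained from \<open>\<theta> ^^ 0\<close>, \<open>\<theta> ^^ 1\<close>, \<open>\<theta> ^^ 2\<close>
  are linearly independent (\<open>dim_shifted_intersection\<close>). Such functionals are determined by their
  values on the subgeometry. There the first one can be used as a coordinate \<open>x\<close> running through
  \<open>F\<close>, and the second one becomes a linearized polynomial \<open>G x = (\<Sum>i<n. b i * x ^ (q ^ i))\<close> with the same linear
  set as \<open>psi\<close> (\<open>subgeometry_polynomial\<close>). It remains to exclude a nontrivial relation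
  \<open>(\<Sum>i<3. c i * (\<theta> ^^ i) x + d i * (\<theta> ^^ i) (G x)) = 0\<close>.

  The polynomial \<open>G\<close> need not be equivalent to \<open>psi\<close>, but two facts about its coefficients suffice. First,
  the power sums of \<open>G x / x\<close> depend only on the linear set, since each of its points comes
  from a number of \<open>x\<close> that is constant modulo the characteristic. This gives
  \<open>b k * b (n - k) ^ (q ^ k) = a k * a (n - k) ^ (q ^ k)\<close> for \<open>0 < k < n\<close>, where \<open>a\<close> are the coefficients of \<open>psi\<close>
  (\<open>slopes_eq_imp_coeff_products_eq\<close>). As the support of \<open>a\<close> consists of the four indices congruent to \<open>s\<close> or \<open>- s\<close>
  modulo \<open>t\<close> (\<open>psi_coefficients\<close>), \<open>b k\<close> and \<open>b (n - k)\<close> are both nonzero for exactly these four indices \<open>k\<close>.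
  Secondly, comparing coefficients in the relation shows that the \<open>b k\<close>, listed along powers of \<open>\<theta>\<close>,
  satisfy a three-term recurrence with coefficients \<open>d\<close>. A sequence with such a recurrence has few
  zeros, or few nonzero entries, or a periodic zero pattern; none of these fits with one of
  \<open>b k\<close>, \<open>b (n - k)\<close> vanishing for all but four \<open>k\<close>
  (\<open>support_gap_contradiction\<close>, \<open>no_short_relation\<close>).
\<close>

section \<open>Character sums over a finite field\<close>

text \<open>
  A translation by \<open>a\<close> permutes \<open>S\<close>; comparing the sums of the elements before and after it gives
  \<open>card S * a = 0\<close>.
\<close>

lemma card_eq_0_if_add_closed:
  fixes S :: "'a::{field,finite} set"
  assumes add: "\<And>x y. x \<in> S \<Longrightarrow> y \<in> S \<Longrightarrow> x + y \<in> S" and a: "a \<in> S" "a \<noteq> 0"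
  shows "of_nat (card S) = (0::'a)"
proof -
  have "inj_on (\<lambda>x. x + a) S" by simp
  moreover have "(\<lambda>x. x + a) ` S \<subseteq> S" using add a by auto
  ultimately have "bij_betw (\<lambda>x. x + a) S S"
    by (metis bij_betw_def endo_inj_surj finite)
  then have "(\<Sum>x\<in>S. x + a) = (\<Sum>x\<in>S. x)" by (rule sum.reindex_bij_betw)
  then have "of_nat (card S) * a = 0" by (simp add: sum.distrib)
  with a show ?thesis by simp
qed

lemma card_power_eq_le:
  fixes c :: "'a::{field,finite}"
  assumes "k > 0"
  shows "card {x. x ^ k = c} \<le> k"
proof -
  define p where "p = monom 1 k + [:- c:]"
  have "degree p = k"
    unfolding p_def using assms by (subst degree_add_eq_left) (auto simp: degree_monom_eq)
  moreover from this have "p \<noteq> 0" using assms by auto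
  moreover have "{x. x ^ k = c} = {x. poly p x = 0}" by (auto simp: p_def poly_monom)
  ultimately show ?thesis using card_poly_roots_bound[of p] by metis
qed

text \<open>
  Multiplying the summation variable by \<open>y\<close> multiplies the sum by \<open>\<eta> y\<close>, a factor different from \<open>1\<close>.
\<close>

lemma sum_nonzero_character:
  fixes \<eta> :: "'a::{field,finite} \<Rightarrow> 'a"
  assumes mult: "\<And>x y. \<eta> (x * y) = \<eta> x * \<eta> y" and y: "y \<noteq> 0" "\<eta> y \<noteq> 1"
  shows "(\<Sum>x\<in>-{0}. \<eta> x) = 0"
proof -
  have "(\<Sum>x\<in>-{0}. \<eta> x) = (\<Sum>x\<in>-{0}. \<eta> (y * x))"
    by (rule sum.reindex_bij_witness[of _ "\<lambda>x. y * x" "\<lambda>x. x / y"]) (use y in auto)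
  also have "\<dots> = \<eta> y * (\<Sum>x\<in>-{0}. \<eta> x)" by (simp add: mult sum_distrib_left)
  finally show ?thesis using y by (metis mult_cancel_right1)
qed

text \<open>
  Uniqueness of base-\<open>q\<close> digits, in the one case that the sum of \<open>(f x / x) ^ (1 + q ^ k)\<close> requires:
  the right-hand side is not divisible by \<open>q\<close>, so one of the two powers on the left is \<open>1\<close>.
\<close>

lemma power_pos_add_power_eq_iff:
  fixes q :: nat
  assumes q: "q \<ge> 2" and k: "k > 0"
  shows "q ^ i + q ^ j = 1 + q ^ k \<longleftrightarrow> (i = 0 \<and> j = k) \<or> (i = k \<and> j = 0)"
proof
  assume eq: "q ^ i + q ^ j = 1 + q ^ k"
  have "i = 0 \<or> j = 0"
  proof (rule ccontr)
    assume "\<not> ?thesis"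
    then have "q dvd q ^ i + q ^ j" by (auto intro: dvd_add dvd_power)
    moreover have "q dvd q ^ k" using k by (simp add: dvd_power)
    ultimately have "q dvd 1" using eq by (metis dvd_add_left_iff)
    with q show False by simp
  qed
  then show "(i = 0 \<and> j = k) \<or> (i = k \<and> j = 0)" using eq q by auto
next
  assume "(i = 0 \<and> j = k) \<or> (i = k \<and> j = 0)"
  then show "q ^ i + q ^ j = 1 + q ^ k" by (elim disjE conjE) simp_all
qed

text \<open>
  The field \<open>GF(q ^ n)\<close>, seen as an extension of its subfield \<open>Fq q\<close> of order \<open>q\<close>. The argument
  \<open>K\<close> names the type of the field.
\<close>

locale finite_field_extension =
  fixes q n :: nat and K :: "'a::{field,finite} itself"
  assumes q: "primepow q" and card_K: "CARD('a) = q ^ n"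
begin

lemma q_ge_2: "q \<ge> 2"
  using primepow_gt_Suc_0[OF q] by simp

lemma n_pos: "n > 0"
proof (rule ccontr)
  assume "\<not> n > 0"
  then have "CARD('a) = 1" using card_K by simp
  moreover have "card {0, 1::'a} \<le> CARD('a)" by (intro card_mono) auto
  ultimately show False by simp
qed

lemma card_nonzero: "card (-{0::'a}) = q ^ n - 1"
  by (simp add: Compl_eq_Diff_UNIV card_Diff_singleton card_K)

lemma of_nat_q: "of_nat q = (0::'a)"
proof -
  have "of_nat (q ^ n) = (0::'a)"
    using card_eq_0_if_add_closed[of "UNIV::'a set" 1] by (simp add: card_K)
  then show ?thesis by (metis of_nat_power power_eq_0_iff)
qed

lemma frob_add: "(x + y :: 'a) ^ (q ^ i) = x ^ (q ^ i) + y ^ (q ^ i)"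
proof -
  from q have "\<exists>p k. prime p \<and> k > 0 \<and> q = p ^ k" by (simp only: primepow_def)
  then obtain p k where p: "prime p" "k > 0" "q = p ^ k" by (elim exE conjE)
  have "of_nat p = (0::'a)" using of_nat_q p by (metis of_nat_power power_eq_0_iff)
  then have dvd: "CHAR('a) dvd p" using of_nat_eq_0_iff_char_dvd by blast
  have "CHAR('a) \<noteq> 1" by (simp only: One_nat_def CHAR_not_1 not_False_eq_True)
  with dvd p(1) have CHAR: "CHAR('a) = p" by (meson prime_nat_iff)
  have "q ^ i = CHAR('a) ^ (k * i)" by (simp only: CHAR p(3) power_mult)
  then show ?thesis using p(1) CHAR by (intro freshmans_dream'[where n = "k * i"]) simp_all
qed

lemma frob_sum: "(\<Sum>j\<in>J. f j :: 'a) ^ (q ^ i) = (\<Sum>j\<in>J. f j ^ (q ^ i))"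
proof (induction J rule: infinite_finite_induct)
  case (insert j J)
  then show ?case by (simp only: sum.insert[OF insert(1,2)] frob_add)
qed (use q_ge_2 in \<open>simp_all add: power_0_left\<close>)

lemma frob_uminus: "(- x :: 'a) ^ (q ^ i) = - (x ^ (q ^ i))"
proof -
  have "x ^ (q ^ i) + (- x) ^ (q ^ i) = 0"
    using frob_add[of x "- x" i] q_ge_2 by (simp add: power_0_left)
  then show ?thesis by (simp add: eq_neg_iff_add_eq_0 add.commute)
qed

lemma power_card_nonzero: 
  assumes "x \<noteq> (0::'a)" shows "x ^ (q ^ n - 1) = 1"
proof -
  have "(\<Prod>y\<in>-{0}. x * y) = (\<Prod>y\<in>-{0}. y)"
    by (rule prod.reindex_bij_witness[of _ "\<lambda>y. y / x" "\<lambda>y. x * y"]) (use assms in auto)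
  then have "x ^ (q ^ n - 1) * \<Prod>(-{0}) = \<Prod>(-{0})"
    by (simp add: prod.distrib card_nonzero)
  moreover have "\<Prod>(-{0::'a}) \<noteq> 0" by simp
  ultimately show ?thesis by simp
qed

lemma frob_period: "x ^ (q ^ n) = (x::'a)"
proof (cases "x = 0")
  case False
  have "x ^ (q ^ n) = x ^ Suc (q ^ n - 1)" using q_ge_2 by simp
  then show ?thesis using power_card_nonzero[OF False] by simp
qed (use q_ge_2 in simp)

lemma frob_mult_period: "x ^ (q ^ (n * k)) = (x::'a)"
  by (induction k) (simp_all add: frob_period power_add power_mult)

lemma frob_mod: "x ^ (q ^ (i mod n)) = (x::'a) ^ (q ^ i)"
proof -
  have "x ^ (q ^ i) = x ^ (q ^ (n * (i div n)) * q ^ (i mod n))" by (simp flip: power_add)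
  also have "\<dots> = x ^ (q ^ (i mod n))" by (simp only: power_mult[of x "q ^ (n * (i div n))"] frob_mult_period)
  finally show ?thesis by simp
qed

text \<open>
  The map \<open>x \<mapsto> x ^ a / x ^ b\<close> is a character of the multiplicative group. The bound on the exponents
  keeps \<open>\<bar>a - b\<bar>\<close> below the order of that group, so for \<open>a \<noteq> b\<close> the polynomial \<open>x ^ \<bar>a - b\<bar> - 1\<close> has too few
  roots for the character to be trivial. For \<open>a = b\<close> the sum counts \<open>q ^ n - 1\<close> elements, which is
  \<open>-1\<close> in characteristic dividing \<open>q\<close>.
\<close>

lemma sum_power_quotient:
  assumes "a < b + (q ^ n - 1)" "b < a + (q ^ n - 1)"
  shows "(\<Sum>x\<in>-{0::'a}. x ^ a / x ^ b) = (if a = b then -1 else 0)"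
proof (cases "a = b")
  case True
  have "(\<Sum>x\<in>-{0::'a}. x ^ a / x ^ b) = (\<Sum>x\<in>-{0::'a}. 1)" 
    using True by (intro sum.cong) auto
  also have "\<dots> = of_nat (q ^ n - 1)" by (simp add: card_nonzero)
  also have "\<dots> = -1" using q_ge_2 n_pos of_nat_q by (simp add: of_nat_diff)
  finally show ?thesis using True by simp
next
  case False
  define d where "d = (if a < b then b - a else a - b)"
  have d: "d > 0" "d < q ^ n - 1" using False assms by (auto simp: d_def)
  have "card {x::'a. x ^ d = 1} < card (-{0::'a})"
    using card_power_eq_le[OF d(1), of "1::'a"] d(2) card_nonzero by linarith
  then have "\<not> - {0::'a} \<subseteq> {x. x ^ d = 1}"
    by (meson card_mono finite linorder_not_less)
  then obtain y :: 'a where y: "y \<noteq> 0" "y ^ d \<noteq> 1" by auto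
  have "y ^ a / y ^ b \<noteq> 1"
  proof
    assume "y ^ a / y ^ b = 1"
    then have "y ^ a = y ^ b" using y by (auto simp: field_simps)
    then have "y ^ d = 1" using y(1)
      by (cases "a < b") (simp_all add: d_def power_diff)
    with y show False by simp
  qed
  then show ?thesis using False
    by (simp, intro sum_nonzero_character[of _ y])
       (auto simp: y power_mult_distrib)
qed

text \<open>
  Dividing by \<open>x ^ (q ^ j)\<close> and summing thus reads off, up to sign, the coefficient of \<open>x ^ (q ^ j)\<close> in a linearized
  polynomial.
\<close>

lemma frob_orthogonality:
  "(\<Sum>x\<in>-{0::'a}. x ^ (q ^ i) / x ^ (q ^ j)) = (if [i = j] (mod n) then -1 else 0)"
proof -
  have bound: "q ^ (i mod n) < q ^ (j mod n) + (q ^ n - 1)" for i j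
  proof -
    have "q ^ (i mod n) < q ^ n" using q_ge_2 n_pos by (intro power_strict_increasing) auto
    moreover have "q ^ (j mod n) \<ge> 1" using q_ge_2 by simp
    ultimately show ?thesis by linarith
  qed
  have "(\<Sum>x\<in>-{0::'a}. x ^ (q ^ i) / x ^ (q ^ j))
      = (\<Sum>x\<in>-{0::'a}. x ^ (q ^ (i mod n)) / x ^ (q ^ (j mod n)))"
    by (simp add: frob_mod)
  also have "\<dots> = (if q ^ (i mod n) = q ^ (j mod n) then -1 else 0)"
    by (rule sum_power_quotient) (rule bound)+
  also have "\<dots> = (if [i = j] (mod n) then -1 else 0)"
    using q_ge_2 by (simp add: cong_def power_inject_exp)
  finally show ?thesis .
qed

text \<open>
  The analogue for products of two Frobenius powers, which extracts quadratic expressions in the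
  coefficients of a linearized polynomial.
\<close>

lemma frob_pair_orthogonality:
  assumes "i < n" "j < n" "0 < k" "k < n"
  shows "(\<Sum>x\<in>-{0::'a}. x ^ (q ^ i + q ^ j) / x ^ (1 + q ^ k))
       = (if (i = 0 \<and> j = k) \<or> (i = k \<and> j = 0) then -1 else 0)"
proof -
  have le: "2 * q ^ i \<le> q ^ n" if "i < n" for i
  proof -
    have "2 * q ^ i \<le> q ^ Suc i" using q_ge_2 by simp
    also have "\<dots> \<le> q ^ n" using that q_ge_2 by (intro power_increasing) auto
    finally show ?thesis .
  qed
  have ge: "q ^ l \<ge> 1" for l using q_ge_2 by simp
  have "q ^ i + q ^ j \<le> q ^ n" "1 + q ^ k \<le> q ^ n"
    using le[OF assms(1)] le[OF assms(2)] le[OF assms(4)] ge[of k] by linarith+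
  then have "(\<Sum>x\<in>-{0::'a}. x ^ (q ^ i + q ^ j) / x ^ (1 + q ^ k))
       = (if q ^ i + q ^ j = 1 + q ^ k then -1 else 0)"
    using ge[of i] ge[of j] ge[of k] by (intro sum_power_quotient) linarith+
  then show ?thesis using power_pos_add_power_eq_iff[OF q_ge_2 assms(3)] by simp
qed

end

section \<open>Linearized polynomials and their slopes\<close>

text \<open>
  The \<open>q\<close>-polynomials of \<open>q\<close>-degree less than \<open>n\<close>. On \<open>GF(q ^ n)\<close> they are precisely the
  \<open>GF(q)\<close>-linear maps; the proof below uses this in the form of \<open>linearized_interpolation\<close>.
\<close>

definition linearized :: "nat \<Rightarrow> nat \<Rightarrow> (nat \<Rightarrow> 'a::field) \<Rightarrow> 'a \<Rightarrow> 'a" where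
  "linearized q n e x = (\<Sum>i<n. e i * x ^ (q ^ i))"

text \<open>
  The set of points of the linear set \<open>{\<langle>(x, f x)\<rangle> | x \<noteq> 0}\<close> of the projective line, in the affine
  coordinate \<open>y / x\<close>.
\<close>

definition slopes :: "('a::field \<Rightarrow> 'a) \<Rightarrow> 'a set" where
  "slopes f = (\<lambda>x. f x / x) ` (- {0})"

lemma Fq_power: "c \<in> Fq q \<Longrightarrow> c ^ (q ^ i) = c"
  by (induction i) (simp_all add: Fq_def power_mult)

lemma zero_in_Fq: "q > 0 \<Longrightarrow> 0 \<in> Fq q" and one_in_Fq: "1 \<in> Fq q"
  by (simp_all add: Fq_def)

lemma Fq_divide: "a \<in> Fq q \<Longrightarrow> b \<in> Fq q \<Longrightarrow> a / b \<in> Fq q"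
  by (simp add: Fq_def power_divide)

lemma Fq_mult: "a \<in> Fq q \<Longrightarrow> b \<in> Fq q \<Longrightarrow> a * b \<in> Fq q"
  by (simp add: Fq_def power_mult_distrib)

context finite_field_extension
begin

lemma Fq_add: "a \<in> Fq q \<Longrightarrow> b \<in> Fq q \<Longrightarrow> a + b \<in> (Fq q :: 'a set)"
  using frob_add[of a b 1] by (simp add: Fq_def)

lemma Fq_uminus: "a \<in> Fq q \<Longrightarrow> - a \<in> (Fq q :: 'a set)"
  using frob_uminus[of a 1] by (simp add: Fq_def)

text \<open>
  With \<open>M = (q ^ n - 1) / (q - 1)\<close>, the map \<open>x \<mapsto> x ^ M\<close> (the norm) sends nonzero elements to
  nonzero elements of \<open>Fq q\<close>, and each fibre has at most \<open>M\<close> elements. So there are at least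
  \<open>q - 1\<close> fibres.
\<close>

lemma card_Fq_ge: "q \<le> card (Fq q :: 'a set)"
proof -
  define M where "M = (\<Sum>i<n. q ^ i)"
  have "(q - 1) * (\<Sum>i<k. q ^ i) + 1 = q ^ k" for k
  proof (induction k)
    case (Suc k)
    have "(q - 1) * (\<Sum>i<Suc k. q ^ i) + 1 = (q - 1) * q ^ k + q ^ k"
      using Suc by (simp add: distrib_left)
    also have "\<dots> = (q - 1 + 1) * q ^ k" by (simp only: distrib_right mult_1)
    also have "\<dots> = q ^ Suc k" using q_ge_2 by simp
    finally show ?case .
  qed simp
  from this[of n] have M: "q ^ n - 1 = (q - 1) * M" unfolding M_def by linarith
  have "q ^ 0 \<le> M" unfolding M_def using n_pos by (intro member_le_sum) auto
  then have M_pos: "M > 0" by simp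
  have "- {0::'a} \<subseteq> (\<Union>c\<in>Fq q - {0}. {x. x ^ M = c})"
  proof
    fix x :: 'a assume "x \<in> - {0}"
    then have x: "x \<noteq> 0" by simp
    have "(x ^ M) ^ (q - 1) = 1"
      using power_card_nonzero[OF x] by (simp only: M power_mult[symmetric] mult.commute)
    then have "(x ^ M) ^ Suc (q - 1) = x ^ M" by simp
    then have "x ^ M \<in> Fq q" using q_ge_2 by (simp add: Fq_def)
    then show "x \<in> (\<Union>c\<in>Fq q - {0}. {x. x ^ M = c})" using x by simp
  qed
  then have "card (- {0::'a}) \<le> card (\<Union>c\<in>Fq q - {0::'a}. {x. x ^ M = c})"
    by (intro card_mono) simp_all
  also have "\<dots> \<le> (\<Sum>c\<in>Fq q - {0::'a}. card {x. x ^ M = c})"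
    by (intro card_UN_le) simp
  also have "\<dots> \<le> (\<Sum>c\<in>Fq q - {0::'a}. M)"
    by (intro sum_mono card_power_eq_le M_pos)
  also have "\<dots> = (card (Fq q :: 'a set) - 1) * M"
    using q_ge_2 by (simp add: card_Diff_singleton zero_in_Fq)
  finally have "q - 1 \<le> card (Fq q :: 'a set) - 1" using M_pos by (simp only: card_nonzero M mult_le_cancel2)
  moreover have "(0::'a) \<in> Fq q" using q_ge_2 by (simp add: zero_in_Fq)
  then have "card (Fq q :: 'a set) \<noteq> 0" by auto
  ultimately show ?thesis by linarith
qed

lemma linearized_add: "linearized q n e (x + y :: 'a) = linearized q n e x + linearized q n e y"
  by (simp add: linearized_def frob_add distrib_left sum.distrib)

lemma linearized_scale: "c \<in> Fq q \<Longrightarrow> linearized q n e (c * x :: 'a) = c * linearized q n e x"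
  by (simp add: linearized_def power_mult_distrib Fq_power sum_distrib_left mult.left_commute)

lemma linearized_0: "linearized q n e (0::'a) = 0"
  using q_ge_2 by (simp add: linearized_def power_0_left)

lemma linearized_sum: "linearized q n e (\<Sum>j\<in>J. f j :: 'a) = (\<Sum>j\<in>J. linearized q n e (f j))"
  by (induction J rule: infinite_finite_induct) (simp_all add: linearized_add linearized_0)

text \<open>
  A power of the Frobenius automorphism moves the coefficient with index \<open>l - m\<close> to index \<open>l\<close>
  and raises it to the power \<open>q ^ m\<close>; orthogonality extracts it.
\<close>

lemma linearized_frob_coeff:
  assumes "m \<le> l"
  shows "(\<Sum>x\<in>-{0::'a}. linearized q n e x ^ (q ^ m) / x ^ (q ^ l)) = - (e ((l - m) mod n) ^ (q ^ m))"
proof -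
  have cong: "[i + m = l] (mod n) \<longleftrightarrow> i = (l - m) mod n" if "i < n" for i
  proof -
    have "[i + m = l] (mod n) \<longleftrightarrow> [i + m = (l - m) + m] (mod n)" using assms by simp
    also have "\<dots> \<longleftrightarrow> [i = l - m] (mod n)" by (rule cong_add_rcancel_nat)
    finally show ?thesis using that by (simp add: cong_def)
  qed
  have "(\<Sum>x\<in>-{0::'a}. linearized q n e x ^ (q ^ m) / x ^ (q ^ l))
      = (\<Sum>x\<in>-{0::'a}. \<Sum>i<n. e i ^ (q ^ m) * (x ^ (q ^ (i + m)) / x ^ (q ^ l)))"
    by (simp add: linearized_def frob_sum power_mult_distrib power_add sum_divide_distrib flip: power_mult)
  also have "\<dots> = (\<Sum>i<n. e i ^ (q ^ m) * (\<Sum>x\<in>-{0::'a}. x ^ (q ^ (i + m)) / x ^ (q ^ l)))"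
    unfolding sum_distrib_left by (rule sum.swap)
  also have "\<dots> = (\<Sum>i<n. if i = (l - m) mod n then - (e i ^ (q ^ m)) else 0)"
    unfolding frob_orthogonality by (intro sum.cong) (auto simp: cong)
  also have "\<dots> = - (e ((l - m) mod n) ^ (q ^ m))" using n_pos by simp
  finally show ?thesis .
qed

lemma linearized_coeff:
  "(\<Sum>x\<in>-{0::'a}. linearized q n e x / x ^ (q ^ l)) = - e (l mod n)"
  using linearized_frob_coeff[of 0 l e] by simp

lemma linearized_eqD:
  assumes "\<And>x::'a. linearized q n a x = linearized q n b x" "i < n"
  shows "a i = b i"
  using linearized_coeff[of a i] linearized_coeff[of b i] assms by simp

lemma linearized_frob:
  assumes "k \<le> n"
  shows "linearized q n e (x::'a) ^ (q ^ k) 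
       = linearized q n (\<lambda>j. e ((j + (n - k)) mod n) ^ (q ^ k)) x"
proof -
  have inv: "((j + a) mod n + b) mod n = j" if "a + b = n" "j < n" for a b j
  proof -
    have "((j + a) mod n + b) mod n = (j + a + b) mod n" by (simp add: mod_add_left_eq)
    then show ?thesis using that by (simp add: add.assoc)
  qed
  have "linearized q n e x ^ (q ^ k) = (\<Sum>j<n. e j ^ (q ^ k) * x ^ (q ^ (j + k)))"
    by (simp add: linearized_def frob_sum power_mult_distrib power_add flip: power_mult)
  also have "\<dots> = (\<Sum>j<n. e j ^ (q ^ k) * x ^ (q ^ ((j + k) mod n)))"
    by (simp add: frob_mod)
  also have "\<dots> = (\<Sum>j<n. e ((j + (n - k)) mod n) ^ (q ^ k) * x ^ (q ^ j))"
  proof (rule sum.reindex_bij_witness[of _ "\<lambda>j. (j + (n - k)) mod n" "\<lambda>j. (j + k) mod n"])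
    show "((j + k) mod n + (n - k)) mod n = j" "((j + (n - k)) mod n + k) mod n = j"
      if "j \<in> {..<n}" for j
      using that assms inv[of k "n - k" j] inv[of "n - k" k j] by simp_all
    then show "e ((((j + k) mod n) + (n - k)) mod n) ^ (q ^ k) * x ^ (q ^ ((j + k) mod n))
        = e j ^ (q ^ k) * x ^ (q ^ ((j + k) mod n))" if "j \<in> {..<n}" for j
      using that by metis
  qed (use n_pos in auto)
  finally show ?thesis by (simp add: linearized_def)
qed

text \<open>
  Evaluation at the \<open>n\<close> elements \<open>X j\<close> maps coefficient sequences of length \<open>n\<close> to value sequences of
  length \<open>n\<close>. It is injective because the \<open>X j\<close> span the field over \<open>Fq q\<close> and the coefficients are
  determined by the values on the whole field; as both sides are finite sets of the same size, it is
  surjective.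
\<close>

lemma linearized_interpolation:
  fixes X Y :: "'b \<Rightarrow> 'a"
  assumes J: "finite J" "card J = n"
    and span: "\<And>x. \<exists>c. (\<forall>j\<in>J. c j \<in> Fq q) \<and> x = (\<Sum>j\<in>J. c j * X j)"
  shows "\<exists>e. \<forall>j\<in>J. linearized q n e (X j) = Y j"
proof -
  define ev where "ev e = restrict (\<lambda>j. linearized q n e (X j)) J" for e :: "nat \<Rightarrow> 'a"
  define D where "D = ({..<n} \<rightarrow>\<^sub>E UNIV :: (nat \<Rightarrow> 'a) set)"
  define R where "R = (J \<rightarrow>\<^sub>E UNIV :: ('b \<Rightarrow> 'a) set)"
  have "inj_on ev D"
  proof (rule inj_onI)
    fix a b assume ab: "a \<in> D" "b \<in> D" "ev a = ev b"
    have "linearized q n a x = linearized q n b x" for x :: 'a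
    proof -
      obtain c where c: "\<forall>j\<in>J. c j \<in> Fq q" "x = (\<Sum>j\<in>J. c j * X j)" using span by blast
      have "linearized q n a (X j) = linearized q n b (X j)" if "j \<in> J" for j
        using fun_cong[OF ab(3), of j] that by (simp add: ev_def)
      then show ?thesis using c by (simp add: linearized_sum linearized_scale)
    qed
    then have "a i = b i" if "i < n" for i using linearized_eqD that by blast
    then show "a = b" using ab(1,2) unfolding D_def by (intro PiE_ext) auto
  qed
  moreover have "ev ` D \<subseteq> R" by (auto simp: ev_def R_def)
  moreover have "card D = card R" using J by (simp add: D_def R_def card_PiE)
  moreover have "finite R" unfolding R_def using J by (intro finite_PiE) auto
  ultimately have "ev ` D = R" by (metis card_image card_subset_eq)
  moreover have "restrict Y J \<in> R" by (simp add: R_def)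
  ultimately obtain e where "ev e = restrict Y J" by (metis imageE)
  then have "linearized q n e (X j) = Y j" if "j \<in> J" for j
    using that by (metis ev_def restrict_apply')
  then show ?thesis by blast
qed

text \<open>
  The nonzero \<open>x\<close> with \<open>f x = \<mu> x\<close>, together with \<open>0\<close>, form an additive group whose order vanishes in the
  field. Hence every slope is attained by a number of \<open>x\<close> that equals \<open>-1\<close> in the field, and the power
  sums of \<open>f x / x\<close> depend on the set of slopes alone, not on the multiplicities.
\<close>

lemma sum_over_slopes:
  fixes f G :: "'a \<Rightarrow> 'a"
  assumes add: "\<And>x y. f (x + y) = f x + f y"
  shows "(\<Sum>x\<in>-{0}. G (f x / x)) = - (\<Sum>\<mu>\<in>slopes f. G \<mu>)"
proof -
  have f0: "f 0 = 0" using add[of 0 0] by (metis add_0 add_cancel_right_right)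
  have "(\<Sum>x\<in>-{0}. G (f x / x)) = (\<Sum>\<mu>\<in>slopes f. \<Sum>x\<in>{x \<in> -{0}. f x / x = \<mu>}. G (f x / x))"
    unfolding slopes_def by (rule sum.image_gen) simp
  also have "\<dots> = (\<Sum>\<mu>\<in>slopes f. - G \<mu>)"
  proof (rule sum.cong)
    fix \<mu> assume "\<mu> \<in> slopes f"
    then obtain a where "a \<in> - {0}" "\<mu> = f a / a" unfolding slopes_def by (rule imageE)
    then have a: "a \<noteq> 0" "f a = \<mu> * a" by simp_all
    define S where "S = {x. f x = \<mu> * x}"
    have fibre: "{x \<in> -{0}. f x / x = \<mu>} = S - {0}" by (auto simp: S_def field_simps)
    have "of_nat (card S) = (0::'a)"
      by (rule card_eq_0_if_add_closed[of S a]) (use a in \<open>auto simp: S_def add distrib_left\<close>)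
    moreover have "card S = Suc (card (S - {0}))"
      by (intro card.remove) (auto simp: S_def f0)
    ultimately have "of_nat (card (S - {0})) = (-1::'a)"
      by (simp add: eq_neg_iff_add_eq_0 add.commute)
    moreover have "(\<Sum>x\<in>S - {0}. G (f x / x)) = (\<Sum>x\<in>S - {0}. G \<mu>)"
      by (intro sum.cong) (auto simp: S_def)
    ultimately show "(\<Sum>x\<in>{x \<in> -{0}. f x / x = \<mu>}. G (f x / x)) = - G \<mu>"
      by (simp only: fibre) simp
  qed simp
  finally show ?thesis by (simp add: sum_negf)
qed

text \<open>
  In the product of \<open>linearized q n a x\<close> and its power with exponent \<open>q ^ k\<close>, only the terms
  \<open>x ^ (q ^ i + q ^ j)\<close> with \<open>{i, j} = {0, k}\<close> survive division by \<open>x ^ (1 + q ^ k)\<close> and summation.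
\<close>

lemma sum_slope_pair:
  assumes k: "0 < k" "k < n"
  shows "(\<Sum>x\<in>-{0::'a}. (linearized q n a x / x) ^ (1 + q ^ k))
       = - (a 0 * a 0 ^ (q ^ k) + a k * a (n - k) ^ (q ^ k))"
proof -
  define a' where "a' = (\<lambda>j. a ((j + (n - k)) mod n) ^ (q ^ k))"
  have frob: "linearized q n a x ^ (q ^ k) = linearized q n a' x" for x :: 'a
    using linearized_frob k by (simp add: a'_def)
  have a': "a' 0 = a (n - k) ^ (q ^ k)" "a' k = a 0 ^ (q ^ k)"
    using k by (simp_all add: a'_def)
  have "(linearized q n a x / x) ^ (1 + q ^ k)
      = (\<Sum>i<n. \<Sum>j<n. a i * a' j * (x ^ (q ^ i + q ^ j) / x ^ (1 + q ^ k)))" for x :: 'a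
  proof -
    have "(linearized q n a x / x) ^ (1 + q ^ k)
        = linearized q n a x * linearized q n a' x / x ^ (1 + q ^ k)"
      by (simp add: power_divide frob)
    also have "linearized q n a x * linearized q n a' x
        = (\<Sum>i<n. \<Sum>j<n. (a i * x ^ (q ^ i)) * (a' j * x ^ (q ^ j)))"
      by (simp add: linearized_def sum_product)
    also have "\<dots> / x ^ (1 + q ^ k)
        = (\<Sum>i<n. \<Sum>j<n. a i * a' j * (x ^ (q ^ i + q ^ j) / x ^ (1 + q ^ k)))"
      by (simp only: sum_divide_distrib power_add times_divide_eq_right mult.assoc mult.left_commute)
    finally show ?thesis .
  qed
  then have "(\<Sum>x\<in>-{0::'a}. (linearized q n a x / x) ^ (1 + q ^ k))
      = (\<Sum>x\<in>-{0::'a}. \<Sum>i<n. \<Sum>j<n. a i * a' j * (x ^ (q ^ i + q ^ j) / x ^ (1 + q ^ k)))"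
    by simp
  also have "\<dots> = (\<Sum>i<n. \<Sum>x\<in>-{0::'a}. \<Sum>j<n. a i * a' j * (x ^ (q ^ i + q ^ j) / x ^ (1 + q ^ k)))"
    by (rule sum.swap)
  also have "\<dots> = (\<Sum>i<n. \<Sum>j<n. \<Sum>x\<in>-{0::'a}. a i * a' j * (x ^ (q ^ i + q ^ j) / x ^ (1 + q ^ k)))"
    by (intro sum.cong refl sum.swap)
  also have "\<dots> = (\<Sum>i<n. \<Sum>j<n. a i * a' j * (if (i = 0 \<and> j = k) \<or> (i = k \<and> j = 0) then -1 else 0))"
    unfolding sum_distrib_left[symmetric]
    by (intro sum.cong refl) (simp only: lessThan_iff frob_pair_orthogonality[OF _ _ k])
  also have "\<dots> = (\<Sum>i<n. (if i = 0 then - a 0 * a' k else 0) + (if i = k then - a k * a' 0 else 0))"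
  proof (rule sum.cong)
    fix i assume "i \<in> {..<n}"
    have "(\<Sum>j<n. a i * a' j * (if (i = 0 \<and> j = k) \<or> (i = k \<and> j = 0) then -1 else 0))
        = (\<Sum>j<n. (if j = k then (if i = 0 then - a i * a' j else 0) else 0)
                + (if j = 0 then (if i = k then - a i * a' j else 0) else 0))"
      using k by (intro sum.cong) auto
    then show "(\<Sum>j<n. a i * a' j * (if (i = 0 \<and> j = k) \<or> (i = k \<and> j = 0) then -1 else 0))
        = (if i = 0 then - a 0 * a' k else 0) + (if i = k then - a k * a' 0 else 0)"
      using k n_pos by (simp add: sum.distrib)
  qed simp
  also have "\<dots> = - (a 0 * a 0 ^ (q ^ k) + a k * a (n - k) ^ (q ^ k))"
    using k n_pos by (simp add: sum.distrib a')
  finally show ?thesis .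
qed

text \<open>
  Equality of the linear sets of two linearized polynomials does not make the polynomials
  equivalent, but it forces these relations between the coefficients (a lemma of Csajbok, Marino and
  Polverino). The power sum with exponent \<open>1\<close> gives \<open>a 0 = b 0\<close>, and the one with exponent
  \<open>1 + q ^ k\<close> then gives the claim.
\<close>

lemma slopes_eq_imp_coeff_products_eq:
  fixes a b :: "nat \<Rightarrow> 'a"
  assumes eq: "slopes (linearized q n a) = slopes (linearized q n b)" and k: "0 < k" "k < n"
  shows "a k * a (n - k) ^ (q ^ k) = b k * b (n - k) ^ (q ^ k)"
proof -
  have sum_eq: "(\<Sum>x\<in>-{0}. G (linearized q n a x / x)) = (\<Sum>x\<in>-{0}. G (linearized q n b x / x))"
    for G :: "'a \<Rightarrow> 'a"
    by (simp add: sum_over_slopes linearized_add eq)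
  have "- a 0 = - b 0"
    using sum_eq[of "\<lambda>\<mu>. \<mu>"] linearized_coeff[of a 0] linearized_coeff[of b 0] by simp
  moreover have "a 0 * a 0 ^ (q ^ k) + a k * a (n - k) ^ (q ^ k)
      = b 0 * b 0 ^ (q ^ k) + b k * b (n - k) ^ (q ^ k)"
    using sum_eq[of "\<lambda>\<mu>. \<mu> ^ (1 + q ^ k)"] unfolding sum_slope_pair[OF k] by (simp only: neg_equal_iff_equal)
  ultimately show ?thesis by simp
qed

text \<open>
  As an \<open>Fq q\<close>-linear map, \<open>\<theta>\<close> is a linearized polynomial with some coefficients \<open>e i\<close>. Comparing
  coefficients in \<open>\<theta> (x * y) = \<theta> y * \<theta> x\<close> gives \<open>e i * y ^ (q ^ i) = \<theta> y * e i\<close>, and any nonzero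
  \<open>e i\<close> can be cancelled. The family \<open>X\<close> provides the \<open>n\<close> interpolation points.
\<close>

lemma Fq_automorphism_is_frob_power:
  fixes \<theta> :: "'a \<Rightarrow> 'a" and X :: "'b \<Rightarrow> 'a"
  assumes \<theta>: "field_automorphism \<theta>" and fix_Fq: "\<And>c. c \<in> Fq q \<Longrightarrow> \<theta> c = c"
    and J: "finite J" "card J = n"
    and span: "\<And>x. \<exists>c. (\<forall>j\<in>J. c j \<in> Fq q) \<and> x = (\<Sum>j\<in>J. c j * X j)"
  shows "\<exists>r. \<forall>x. \<theta> x = x ^ (q ^ r)"
proof -
  have add: "\<theta> (x + y) = \<theta> x + \<theta> y" and mult: "\<theta> (x * y) = \<theta> x * \<theta> y" for x y
    using \<theta> by (auto simp: field_automorphism_def)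
  have \<theta>0: "\<theta> 0 = 0" using add[of 0 0] by (metis add_0 add_cancel_right_right)
  have \<theta>_sum: "\<theta> (\<Sum>j\<in>J'. f j) = (\<Sum>j\<in>J'. \<theta> (f j))" for J' and f :: "'b \<Rightarrow> 'a"
    by (induction J' rule: infinite_finite_induct) (simp_all add: add \<theta>0)
  obtain e where e: "\<forall>j\<in>J. linearized q n e (X j) = \<theta> (X j)"
    using linearized_interpolation[OF J span, of "\<lambda>j. \<theta> (X j)"] by blast
  have lin: "linearized q n e x = \<theta> x" for x
  proof -
    obtain c where c: "\<forall>j\<in>J. c j \<in> Fq q" "x = (\<Sum>j\<in>J. c j * X j)" using span by blast
    then show ?thesis by (simp add: linearized_sum linearized_scale \<theta>_sum mult fix_Fq e)
  qed
  have coeff: "e i * y ^ (q ^ i) = \<theta> y * e i" if "i < n" for i y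
  proof (rule linearized_eqD[OF _ that])
    fix x
    have "linearized q n (\<lambda>i. e i * y ^ (q ^ i)) x = linearized q n e (x * y)"
      by (simp add: linearized_def power_mult_distrib mult_ac)
    also have "\<dots> = \<theta> y * linearized q n e x" by (simp add: lin mult)
    also have "\<dots> = linearized q n (\<lambda>i. \<theta> y * e i) x"
      by (simp add: linearized_def sum_distrib_left mult_ac)
    finally show "linearized q n (\<lambda>i. e i * y ^ (q ^ i)) x = linearized q n (\<lambda>i. \<theta> y * e i) x" .
  qed
  have "\<theta> 1 = 1" using fix_Fq one_in_Fq by blast
  have "\<exists>i<n. e i \<noteq> 0"
  proof (rule ccontr)
    assume "\<not> ?thesis"
    then have "linearized q n e 1 = 0" by (simp add: linearized_def)
    with \<open>\<theta> 1 = 1\<close> lin[of 1] show False by simp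
  qed
  then obtain i where i: "i < n" "e i \<noteq> 0" by blast
  have "\<theta> y = y ^ (q ^ i)" for y using coeff[OF i(1), of y] i(2) by (simp add: mult.commute)
  then show ?thesis by blast
qed

end

section \<open>The support of the coefficients\<close>

text \<open>
  The condition \<open>k \<equiv> s \<or> k \<equiv> - s\<close> modulo \<open>t\<close>. It describes the support of the
  coefficients of \<open>psi\<close>, and it is invariant under \<open>k \<mapsto> 2 * t - k\<close>.
\<close>

definition sym_residue :: "nat \<Rightarrow> nat \<Rightarrow> nat \<Rightarrow> bool" where
  "sym_residue t s k \<longleftrightarrow> int t dvd int k - int s \<or> int t dvd int k + int s"

lemma sym_residue_mod: "sym_residue t s (k mod (2 * t)) \<longleftrightarrow> sym_residue t s k"
proof -
  have k: "int k = int (k mod (2 * t)) + int t * (2 * int (k div (2 * t)))"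
    using mod_mult_div_eq[of k "2 * t"] by (metis mult.assoc mult.left_commute of_nat_add of_nat_mult of_nat_numeral)
  have "int t dvd int k + z \<longleftrightarrow> int t dvd int (k mod (2 * t)) + z" for z
  proof -
    have "int k + z = (int (k mod (2 * t)) + z) + int t * (2 * int (k div (2 * t)))" using k by simp
    then show ?thesis by (metis dvd_add_times_triv_right_iff mult.commute)
  qed
  from this[of "- int s"] this[of "int s"] show ?thesis by (simp add: sym_residue_def)
qed

lemma sym_residue_reflect:
  assumes "k \<le> 2 * t"
  shows "sym_residue t s (2 * t - k) \<longleftrightarrow> sym_residue t s k"
proof -
  have "int t dvd int (2 * t - k) - z \<longleftrightarrow> int t dvd int k + z" for z
  proof -
    have "int (2 * t - k) - z = 2 * int t - (int k + z)" using assms by (simp add: of_nat_diff)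
    then show ?thesis by (metis dvd_diff_right_iff dvd_triv_right)
  qed
  from this[of "int s"] this[of "- int s"] show ?thesis by (auto simp: sym_residue_def)
qed

text \<open>
  Three field elements whose sum is zero cannot have this pattern of nonzero elements.
\<close>

definition exactly_one :: "bool \<Rightarrow> bool \<Rightarrow> bool \<Rightarrow> bool" where
  "exactly_one x y z \<longleftrightarrow> (x \<and> \<not> y \<and> \<not> z) \<or> (\<not> x \<and> y \<and> \<not> z) \<or> (\<not> x \<and> \<not> y \<and> z)"

text \<open>
  The combinatorial core. \<open>S\<close> is the support of a sequence satisfying a three-term recurrence on the
  positions \<open>1, ..., n - 1\<close>, and \<open>D0\<close>, \<open>D1\<close>, \<open>D2\<close> say which of its coefficients are nonzero; \<open>T\<close> is the
  set of positions \<open>k\<close> such that both \<open>k\<close> and \<open>n - k\<close> are in the support. Since \<open>n - t = t\<close> and \<open>t\<close> is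
  not in \<open>T\<close>, there is a zero in the middle, at \<open>t\<close>. Every shape of the recurrence spreads either
  zeros or nonzero entries too far:
  a single term kills a long interval of positions;
  two adjacent terms make the support constant on an interval containing \<open>t\<close>;
  two terms at distance two make it constant on the odd positions, and then \<open>1\<close> and \<open>3\<close> are in \<open>T\<close>;
  with three terms, two adjacent zeros propagate to all positions, so the zero at \<open>t\<close> has nonzero
  neighbours up to distance two on both sides, and then \<open>t - 1\<close> and \<open>t - 2\<close> are in \<open>T\<close>.
\<close>

lemma support_gap_contradiction:
  fixes S T :: "nat \<Rightarrow> bool"
  assumes t: "t \<ge> 5" and n: "n = 2 * t"
    and window: "\<And>k. 3 \<le> k \<Longrightarrow> k < n \<Longrightarrow>
      \<not> exactly_one (D0 \<and> S k) (D1 \<and> S (k - 1)) (D2 \<and> S (k - 2))"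
    and pair: "\<And>k. 0 < k \<Longrightarrow> k < n \<Longrightarrow> S k \<and> S (n - k) \<longleftrightarrow> T k"
    and T_t: "\<not> T t" and T_13: "\<not> (T 1 \<and> T 3)" and T_12: "\<not> (T (t - 1) \<and> T (t - 2))"
    and k0: "0 < k0" "k0 < t" "T k0" "T (k0 + t)"
    and k1: "odd k1" "k1 < n" "T k1"
  shows "\<not> D0 \<and> \<not> D1 \<and> \<not> D2"
proof -
  have S_T: "S k" if "T k" "0 < k" "k < n" for k using pair that by blast
  have S_k0: "S k0" "S (k0 + t)" using S_T k0 t n by auto
  have S_t: "\<not> S t" using pair[of t] T_t t n by auto
  note window = window[unfolded exactly_one_def]
  have win: "\<not> ((D0 \<and> S (j + 2)) \<and> \<not> (D1 \<and> S (j + 1)) \<and> \<not> (D2 \<and> S j) \<or>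
      \<not> (D0 \<and> S (j + 2)) \<and> (D1 \<and> S (j + 1)) \<and> \<not> (D2 \<and> S j) \<or>
      \<not> (D0 \<and> S (j + 2)) \<and> \<not> (D1 \<and> S (j + 1)) \<and> D2 \<and> S j)"
    if "1 \<le> j" "j + 2 < n" for j
    using window[of "j + 2"] that by simp
  consider (none) "\<not> D0" "\<not> D1" "\<not> D2" | (d0) "D0" "\<not> D1" "\<not> D2" | (d1) "\<not> D0" "D1" "\<not> D2"
    | (d2) "\<not> D0" "\<not> D1" "D2" | (d01) "D0" "D1" "\<not> D2" | (d02) "D0" "\<not> D1" "D2"
    | (d12) "\<not> D0" "D1" "D2" | (d012) "D0" "D1" "D2" by blast
  then show ?thesis
  proof cases
    case none
    then show ?thesis by simp
  next
    case d0
    have "\<not> S (k0 + t)" using window[of "k0 + t"] d0 k0 t n by simp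
    with S_k0 show ?thesis by simp
  next
    case d1
    have mid: "\<not> S j" if "2 \<le> j" "j + 1 < n" for j using win[of "j - 1"] d1 that by simp
    show ?thesis
    proof (cases "k0 = 1")
      case True
      then show ?thesis using mid[of "k0 + t"] S_k0 t n by simp
    next
      case False
      then show ?thesis using mid[of k0] S_k0 k0 t n by simp
    qed
  next
    case d2
    have "\<not> S k0" using win[of k0] d2 k0 t n by simp
    with S_k0 show ?thesis by simp
  next
    case d01
    have "S (k0 + t) = S t"
    proof -
      have "k0 + t < n \<Longrightarrow> S (k0 + t) = S t" 
      proof (induction k0)
        case (Suc k)
        have "S (Suc k + t) = S (k + t)" using window[of "Suc k + t"] d01 Suc t n by auto
        with Suc show ?case by simp
      qed simp
      then show ?thesis using k0 n by simp
    qed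
    with S_k0 S_t show ?thesis by simp
  next
    case d02
    have "S (2 * j + 1) = S 1" if "2 * j + 1 < n" for j
      using that
    proof (induction j)
      case (Suc j)
      have "S (2 * Suc j + 1) = S (2 * j + 1)" using win[of "2 * j + 1"] d02 Suc by auto
      with Suc show ?case by simp
    qed simp
    moreover have "\<exists>j. k = 2 * j + 1" if "odd k" for k using that by (blast elim: oddE)
    ultimately have odd_S: "S k = S 1" if "odd k" "k < n" for k using that by metis
    have "S k1" using S_T k1 by (auto intro: odd_pos)
    then have "S 1" using odd_S k1 by blast
    then have "S k" if "odd k" "k < n" for k using odd_S that by blast
    moreover have "even n" using n by simp
    ultimately have "T 1" "T 3" using pair[of 1] pair[of 3] t n by auto
    with T_13 show ?thesis by simp
  next
    case d12
    have "S (t - j) = S t" if "j < t" for j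
      using that
    proof (induction j)
      case (Suc j)
      have "1 \<le> t - Suc j" "t - Suc j + 2 < n" "t - Suc j + 1 = t - j" using Suc t n by linarith+
      then have "S (t - Suc j) = S (t - j)" using win[of "t - Suc j"] d12 by auto
      with Suc show ?case by simp
    qed simp
    from this[of "t - k0"] have "S k0 = S t" using k0 by simp
    with S_k0 S_t show ?thesis by simp
  next
    case d012
    define Z where "Z j \<longleftrightarrow> \<not> S j \<and> \<not> S (j + 1)" for j
    have step: "Z j = Z (j + 1)" if "1 \<le> j" "j + 2 < n" for j
      using win[OF that] d012 by (auto simp: Z_def)
    have const: "Z j = Z 1" if "1 \<le> j" "j + 1 < n" for j
      using that
    proof (induction j rule: nat_induct_at_least)
      case (Suc j)
      then show ?case using step[of j] by simp
    qed simp
    have "\<not> Z k0" using S_k0 by (simp add: Z_def)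
    then have no_Z: "\<not> Z j" if "1 \<le> j" "j + 1 < n" for j
      using const[of k0] const[OF that] k0 t n by simp
    have "S (t + 1)" using no_Z[of t] S_t t n by (simp add: Z_def)
    moreover have "S (t - 1)" using no_Z[of "t - 1"] S_t t n by (simp add: Z_def)
    moreover have "S (t + 2)" using win[of t] d012 S_t \<open>S (t + 1)\<close> t n by auto
    moreover have "t - 2 + 1 = t - 1" "t - 2 + 2 = t" using t by simp_all
    then have "S (t - 2)" using win[of "t - 2"] d012 S_t \<open>S (t - 1)\<close> t n by auto
    moreover have "n - (t - 1) = t + 1" "n - (t - 2) = t + 2" using t n by simp_all
    ultimately have "T (t - 1)" "T (t - 2)" using pair[of "t - 1"] pair[of "t - 2"] t n by simp_all
    with T_12 show ?thesis by simp
  qed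
qed

text \<open>
  The arithmetic that \<open>support_gap_contradiction\<close> asks of the positions \<open>k\<close> with \<open>r k \<equiv> s\<close> or
  \<open>r k \<equiv> - s\<close> modulo \<open>t\<close>. In the two exclusions, adding or subtracting the two congruences removes
  \<open>s\<close> and leaves \<open>c r \<equiv> 0\<close> modulo \<open>t\<close> with \<open>1 \<le> c \<le> 4\<close>, which is impossible as \<open>r\<close> is prime to \<open>t \<ge> 5\<close>.
  For the odd solution: if \<open>t\<close> is odd, one of \<open>k\<close> and \<open>k + t\<close> is odd; if \<open>t\<close> is even, \<open>r k \<equiv> s\<close> also
  holds modulo \<open>2\<close>, where \<open>s\<close> is odd.
\<close>

lemma sym_residue_multiples:
  fixes r s t :: nat
  assumes t: "t \<ge> 5" and r: "coprime r (2 * t)" and s: "coprime s (2 * t)"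
  shows "\<not> sym_residue t s (r * t)"
    and "\<not> (sym_residue t s (r * 1) \<and> sym_residue t s (r * 3))"
    and "\<not> (sym_residue t s (r * (t - 1)) \<and> sym_residue t s (r * (t - 2)))"
    and "\<exists>k. 0 < k \<and> k < t \<and> sym_residue t s (r * k) \<and> sym_residue t s (r * (k + t))"
    and "\<exists>k. odd k \<and> k < 2 * t \<and> sym_residue t s (r * k)"
proof -
  have cop: "coprime (int t) (int r)" "coprime (int t) (int s)"
    using r s by (simp_all add: coprime_commute)
  have small: False if "int t dvd c * int r" "0 < c" "c \<le> 4" for c
  proof -
    have "int t dvd c" using that(1) cop(1) by (simp add: coprime_dvd_mult_left_iff)
    then have "int t \<le> c" using that(2) by (rule zdvd_imp_le)
    with t that(3) show False by simp
  qed
  have not_dvd_s: "\<not> int t dvd int s"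
  proof
    assume "int t dvd int s"
    then have "is_unit (int t)" using cop(2) by (meson coprime_common_divisor dvd_refl)
    with t show False by simp
  qed
  show "\<not> sym_residue t s (r * t)"
  proof
    assume "sym_residue t s (r * t)"
    then have "int t dvd int s"
      by (auto simp: sym_residue_def dvd_add_right_iff dvd_diff_right_iff)
    with not_dvd_s show False ..
  qed
  show "\<not> (sym_residue t s (r * 1) \<and> sym_residue t s (r * 3))"
  proof
    assume asm: "sym_residue t s (r * 1) \<and> sym_residue t s (r * 3)"
    have *: False if "int t dvd int r - z" "int t dvd 3 * int r - z \<or> int t dvd 3 * int r + z" for z
      using that(2)
    proof
      assume "int t dvd 3 * int r - z"
      from dvd_diff[OF this that(1)] show False by (intro small[of 2]) (auto simp: algebra_simps)
    next
      assume "int t dvd 3 * int r + z"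
      from dvd_add[OF this that(1)] show False by (intro small[of 4]) (auto simp: algebra_simps)
    qed
    from asm show False
      using *[of "int s"] *[of "- int s"] by (auto simp: sym_residue_def mult.commute)
  qed
  show "\<not> (sym_residue t s (r * (t - 1)) \<and> sym_residue t s (r * (t - 2)))"
  proof
    assume asm: "sym_residue t s (r * (t - 1)) \<and> sym_residue t s (r * (t - 2))"
    have reduce: "int t dvd c * int r - z" if "int t dvd int (r * (t - nat c)) + z" "c \<in> {1, 2}" for c z
    proof -
      have "int (r * (t - nat c)) = int r * int t - c * int r"
        using that(2) t by (auto simp: of_nat_diff algebra_simps)
      then have "c * int r - z = int r * int t - (int (r * (t - nat c)) + z)" by simp
      with that(1) show ?thesis by (metis dvd_diff dvd_triv_right)
    qed
    have *: False if "int t dvd int r - z" "int t dvd 2 * int r - z \<or> int t dvd 2 * int r + z" for z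
      using that(2)
    proof
      assume "int t dvd 2 * int r - z"
      from dvd_diff[OF this that(1)] show False by (intro small[of 1]) (auto simp: algebra_simps)
    next
      assume "int t dvd 2 * int r + z"
      from dvd_add[OF this that(1)] show False by (intro small[of 3]) (auto simp: algebra_simps)
    qed
    have "int t dvd int r - int s \<or> int t dvd int r + int s"
      using asm reduce[of 1 "int s"] reduce[of 1 "- int s"] by (auto simp: sym_residue_def)
    moreover have "int t dvd 2 * int r - int s \<or> int t dvd 2 * int r + int s"
      using asm reduce[of 2 "int s"] reduce[of 2 "- int s"] by (auto simp: sym_residue_def)
    ultimately show False using *[of "int s"] *[of "- int s"] by auto
  qed
  have "coprime r t" using r by simp
  then obtain y where "[r * y = 1] (mod t)" using cong_solve_coprime_nat[of r t] by auto
  then have "[r * y * s = 1 * s] (mod t)" by (rule cong_scalar_right)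
  then have "[r * (y * s mod t) = s] (mod t)" by (simp add: cong_def mod_mult_right_eq mult.assoc)
  moreover have "y * s mod t < t" using t by simp
  ultimately obtain k where k: "[r * k = s] (mod t)" "k < t" by blast
  have dvd_k: "int t dvd int (r * k) - int s"
    using k(1) by (metis cong_iff_dvd_diff cong_int_iff)
  have "k \<noteq> 0" using dvd_k not_dvd_s by (metis diff_0 dvd_minus_iff mult_0_right of_nat_0)
  have "int (r * (k + t)) - int s = (int (r * k) - int s) + int t * int r" by (simp add: algebra_simps)
  then have dvd_kt: "int t dvd int (r * (k + t)) - int s" using dvd_k by (metis dvd_add dvd_triv_left)
  show "\<exists>k. 0 < k \<and> k < t \<and> sym_residue t s (r * k) \<and> sym_residue t s (r * (k + t))"
    using dvd_k dvd_kt k(2) \<open>k \<noteq> 0\<close> unfolding sym_residue_def by blast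
  show "\<exists>k. odd k \<and> k < 2 * t \<and> sym_residue t s (r * k)"
  proof (cases "odd k")
    case True
    then show ?thesis using dvd_k k(2) unfolding sym_residue_def by (intro exI[of _ k]) auto
  next
    case False
    have "odd t"
    proof
      assume "even t"
      then have "2 dvd int (r * k) - int s" using dvd_k by (metis dvd_trans even_of_nat_iff)
      moreover have "odd s" using s by simp
      ultimately show False using False by simp
    qed
    then show ?thesis using dvd_kt k(2) False unfolding sym_residue_def by (intro exI[of _ "k + t"]) auto
  qed
qed

context finite_field_extension
begin

text \<open>
  Write \<open>\<theta> x = x ^ (q ^ r)\<close> and let \<open>F\<close> be the polynomial with coefficients \<open>b\<close>. The claim is that
  \<open>x\<close>, \<open>\<theta> x\<close>, \<open>\<theta>\<^sup>2 x\<close>, \<open>F x\<close>, \<open>\<theta> (F x)\<close>, \<open>\<theta>\<^sup>2 (F x)\<close> are linearly independent functions over the field. In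
  terms of \<open>\<theta>\<close> the coefficients of \<open>F\<close> are \<open>\<beta> k = b ((r * k) mod n)\<close>. For \<open>3 \<le> k < n\<close> the first three
  functions do not contribute to the coefficient of \<open>\<theta> ^^ k\<close> in a relation, which therefore says
  that the \<open>d i\<close> form a twisted three-term recurrence satisfied by \<open>\<beta>\<close>.
\<close>

lemma no_short_relation:
  fixes b c d :: "nat \<Rightarrow> 'a"
  assumes t: "t \<ge> 5" and n: "n = 2 * t" and r: "coprime r n" and s: "coprime s n"
    and pair: "\<And>k. 0 < k \<Longrightarrow> k < n \<Longrightarrow> b k \<noteq> 0 \<and> b (n - k) \<noteq> 0 \<longleftrightarrow> sym_residue t s k"
    and rel: "\<And>x. (\<Sum>i<3. c i * x ^ (q ^ (r * i)) + d i * linearized q n b x ^ (q ^ (r * i))) = 0"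
    and i: "i < 3"
  shows "c i = 0 \<and> d i = 0"
proof -
  \<comment> \<open>The coefficients with respect to the powers of \<open>\<theta>\<close>, indexed by the exponent of \<open>\<theta>\<close>.\<close>
  define \<beta> where "\<beta> k = b ((r * k) mod n)" for k
  have coeff: "(\<Sum>i<3. c i * (if i = k then -1 else 0) +
      d i * (\<Sum>x\<in>-{0::'a}. linearized q n b x ^ (q ^ (r * i)) / x ^ (q ^ (r * k)))) = 0" if "k < n" for k
  proof -
    have "[r * i = r * k] (mod n) \<longleftrightarrow> i = k" if "i < 3" for i
      using t n that \<open>k < n\<close> unfolding cong_mult_lcancel_nat[OF r] by (simp add: cong_def)
    then have orth: "(\<Sum>x\<in>-{0::'a}. x ^ (q ^ (r * i)) / x ^ (q ^ (r * k))) = (if i = k then -1 else 0)"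
      if "i < 3" for i using that by (simp add: frob_orthogonality)
    have "(\<Sum>x\<in>-{0::'a}. (\<Sum>i<3. c i * x ^ (q ^ (r * i)) + d i * linearized q n b x ^ (q ^ (r * i)))
        / x ^ (q ^ (r * k))) = 0"
      by (simp add: rel)
    also have "(\<Sum>x\<in>-{0::'a}. (\<Sum>i<3. c i * x ^ (q ^ (r * i)) + d i * linearized q n b x ^ (q ^ (r * i)))
        / x ^ (q ^ (r * k)))
      = (\<Sum>x\<in>-{0::'a}. \<Sum>i<3. c i * (x ^ (q ^ (r * i)) / x ^ (q ^ (r * k)))
            + d i * (linearized q n b x ^ (q ^ (r * i)) / x ^ (q ^ (r * k))))"
      by (simp add: sum_divide_distrib add_divide_distrib)
    also have "\<dots> = (\<Sum>i<3. c i * (\<Sum>x\<in>-{0::'a}. x ^ (q ^ (r * i)) / x ^ (q ^ (r * k)))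
            + d i * (\<Sum>x\<in>-{0::'a}. linearized q n b x ^ (q ^ (r * i)) / x ^ (q ^ (r * k))))"
      by (subst sum.swap) (simp add: sum.distrib sum_distrib_left)
    finally show ?thesis by (simp add: orth)
  qed
  have rec: "(\<Sum>i<3. d i * \<beta> (k - i) ^ (q ^ (r * i))) = 0" if "3 \<le> k" "k < n" for k
  proof -
    have "(\<Sum>x\<in>-{0::'a}. linearized q n b x ^ (q ^ (r * i)) / x ^ (q ^ (r * k))) = - (\<beta> (k - i) ^ (q ^ (r * i)))"
      if "i < 3" for i
      using linearized_frob_coeff[of "r * i" "r * k" b] that \<open>3 \<le> k\<close> by (simp add: \<beta>_def diff_mult_distrib2)
    with coeff[OF that(2)] have "(\<Sum>i<3. - (d i * \<beta> (k - i) ^ (q ^ (r * i)))) = 0"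
      using that(1) by simp
    then show ?thesis by (simp add: sum_negf)
  qed
  have pair': "\<beta> k \<noteq> 0 \<and> \<beta> (n - k) \<noteq> 0 \<longleftrightarrow> sym_residue t s (r * k)" if "0 < k" "k < n" for k
  proof -
    define j where "j = (r * k) mod n"
    have "\<not> n dvd k" using that by (meson dvd_imp_le linorder_not_less)
    then have "\<not> n dvd r * k" using r by (simp add: coprime_commute coprime_dvd_mult_right_iff)
    then have j: "0 < j" "j < n" using that by (auto simp: j_def dvd_eq_mod_eq_0)
    have "[r * (n - k) + r * k = n - j + j] (mod n)"
    proof -
      have "r * (n - k) + r * k = r * n" using that by (simp flip: distrib_left)
      then show ?thesis using j by (simp add: cong_def)
    qed
    moreover have "[r * k = j] (mod n)" by (simp add: cong_def j_def)
    ultimately have "[r * (n - k) = n - j] (mod n)"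
      by (metis cong_add_lcancel_nat cong_add_rcancel_nat cong_sym cong_trans)
    then have "(r * (n - k)) mod n = n - j" using j by (simp add: cong_def)
    then have "\<beta> k \<noteq> 0 \<and> \<beta> (n - k) \<noteq> 0 \<longleftrightarrow> sym_residue t s j"
      using pair[OF j] by (simp add: \<beta>_def j_def)
    then show ?thesis by (simp add: j_def n sym_residue_mod)
  qed
  note res = sym_residue_multiples[OF t r[unfolded n] s[unfolded n]]
  obtain k0 where k0: "0 < k0" "k0 < t" "sym_residue t s (r * k0)" "sym_residue t s (r * (k0 + t))"
    using res(4) by blast
  obtain k1 where k1: "odd k1" "k1 < n" "sym_residue t s (r * k1)" using res(5) n by blast
  have "\<not> d 0 \<noteq> 0 \<and> \<not> d 1 \<noteq> 0 \<and> \<not> d 2 \<noteq> 0"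
  proof (rule support_gap_contradiction[OF t n _ pair' res(1-3) k0 k1])
    fix k assume k: "3 \<le> k" "k < n"
    have "d 0 * \<beta> k + d 1 * \<beta> (k - 1) ^ (q ^ r) + d 2 * \<beta> (k - 2) ^ (q ^ (r * 2)) = 0"
      using rec[OF k] by (simp add: eval_nat_numeral)
    then show "\<not> exactly_one (d 0 \<noteq> 0 \<and> \<beta> k \<noteq> 0) (d 1 \<noteq> 0 \<and> \<beta> (k - 1) \<noteq> 0) (d 2 \<noteq> 0 \<and> \<beta> (k - 2) \<noteq> 0)"
      using q_ge_2 by (auto simp: exactly_one_def power_0_left)
  qed auto
  \<comment> \<open>Only multiples of \<open>x\<close>, \<open>\<theta> x\<close>, \<open>\<theta>\<^sup>2 x\<close> remain, and these are independent.\<close>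
  then have d0: "d i = 0" if "i < 3" for i using that by (auto simp: eval_nat_numeral less_Suc_eq)
  then have "(\<Sum>j<3. c j * (if j = i then -1 else 0)) = 0" using coeff[of i] i t n by simp
  then have "(\<Sum>j<3. if j = i then - c j else 0) = 0" by (simp add: if_distrib cong: if_cong)
  then have "c i = 0" using i by simp
  with d0[OF i] show ?thesis by simp
qed

end

text \<open>
  With \<open>s\<close> odd, the exponents \<open>s (t + 1)\<close>, \<open>s (t - 1)\<close> and \<open>s (2 t - 1)\<close> are congruent to \<open>t + s\<close>, \<open>t - s\<close>
  and \<open>- s\<close> modulo \<open>2 t\<close>. Together with \<open>s\<close> these are the four solutions of \<open>i \<equiv> s\<close> or \<open>i \<equiv> - s\<close> modulo \<open>t\<close>; they
  are distinct because \<open>t\<close> does not divide \<open>2 s\<close>, so that no coefficients cancel.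
\<close>

lemma psi_coefficients:
  fixes m h :: "'a::field"
  assumes t: "t \<ge> 5" and s: "1 \<le> s" "s \<le> 2 * t - 1" "coprime s (2 * t)"
    and period: "\<And>i x::'a. x ^ (q ^ (i mod (2 * t))) = x ^ (q ^ i)"
    and m: "m \<noteq> 0" and h: "h \<noteq> 0"
  shows "\<exists>a. (\<forall>x. psi q t m h s x = linearized q (2 * t) a x) \<and>
             (\<forall>i<2 * t. a i \<noteq> 0 \<longleftrightarrow> sym_residue t s i)"
proof -
  \<comment> \<open>The residues in \<open>{0..<2 * t}\<close> of the other three exponents.\<close>
  define e2 where "e2 = (if s < t then s + t else s - t)"
  define e3 where "e3 = (if s < t then t - s else 3 * t - s)"
  define e4 where "e4 = 2 * t - s"
  define h2 where "h2 = h powi (1 - int (q ^ (s * (t + 1))))"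
  define h4 where "h4 = h powi (1 - int (q ^ (s * (2 * t - 1))))"
  have nz: "h2 \<noteq> 0" "h4 \<noteq> 0" using h by (simp_all add: h2_def h4_def)
  have "odd s" using s(3) by simp
  have "coprime t s" using s(3) by (simp add: coprime_commute)
  then have nd: "\<not> t dvd c * s" if "0 < c" "c \<le> 4" for c :: nat
    using t that by (auto simp: coprime_dvd_mult_left_iff dest: dvd_imp_le)
  have ne: "s \<noteq> t" "2 * s \<noteq> t" "2 * s \<noteq> 3 * t"
    using nd[of 1] nd[of 2] by auto
  have lt: "s < 2 * t" "e2 < 2 * t" "e3 < 2 * t" "e4 < 2 * t"
    using s ne t by (auto simp: e2_def e3_def e4_def)
  have dist: "distinct [s, e2, e3, e4]"
    using s ne t by (auto simp: e2_def e3_def e4_def)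
  obtain u where u: "s = 2 * u + 1" using \<open>odd s\<close> by (blast elim: oddE)
  have m2: "(s * (t + 1)) mod (2 * t) = e2"
  proof -
    have "(s * (t + 1)) mod (2 * t) = (s + t + 2 * t * u) mod (2 * t)"
      by (simp add: u algebra_simps)
    also have "\<dots> = (s + t) mod (2 * t)" by simp
    also have "\<dots> = e2"
    proof (cases "s < t")
      case False
      then have "s + t = (s - t) + 2 * t" by simp
      then have "(s + t) mod (2 * t) = (s - t) mod (2 * t)" by (metis mod_add_self2)
      then show ?thesis using lt(2) False by (simp add: e2_def)
    qed (simp add: e2_def)
    finally show ?thesis .
  qed
  have m3: "(s * (t - 1)) mod (2 * t) = e3"
  proof -
    have "[s * (t - 1) + s = e3 + s] (mod (2 * t))"
    proof -
      have "s * (t - 1) + s = s * (t - 1 + 1)" by (simp only: distrib_left mult_1_right)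
      also have "\<dots> = s * t" using t by simp
      also have "\<dots> = t + 2 * t * u" by (simp add: u algebra_simps)
      finally have "s * (t - 1) + s = t + 2 * t * u" .
      moreover have "(e3 + s) mod (2 * t) = t mod (2 * t)"
      proof (cases "s < t")
        case False
        then have "e3 + s = t + 2 * t" using s by (simp add: e3_def)
        then show ?thesis by simp
      qed (simp add: e3_def)
      ultimately show ?thesis by (simp add: cong_def)
    qed
    then have "[s * (t - 1) = e3] (mod (2 * t))" by (simp only: cong_add_rcancel_nat)
    then show ?thesis using lt by (simp add: cong_def)
  qed
  have m4: "(s * (2 * t - 1)) mod (2 * t) = e4"
  proof -
    have "[s * (2 * t - 1) + s = e4 + s] (mod (2 * t))"
    proof -
      have "s * (2 * t - 1) + s = s * (2 * t - 1 + 1)" by (simp only: distrib_left mult_1_right)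
      also have "\<dots> = s * (2 * t)" using t by simp
      finally have "s * (2 * t - 1) + s = s * (2 * t)" .
      moreover have "e4 + s = 2 * t" using lt by (simp add: e4_def)
      ultimately show ?thesis by (simp add: cong_def)
    qed
    then have "[s * (2 * t - 1) = e4] (mod (2 * t))" by (simp only: cong_add_rcancel_nat)
    then show ?thesis using lt by (simp add: cong_def)
  qed
  define a where "a i = (if i = s then m else 0) + (if i = e2 then - m * h2 else 0)
      + (if i = e3 then 1 else 0) + (if i = e4 then h4 else 0)" for i
  have "linearized q (2 * t) a x = m * x ^ (q ^ s) - m * h2 * x ^ (q ^ e2) + x ^ (q ^ e3) + h4 * x ^ (q ^ e4)" for x
    using lt by (simp add: linearized_def a_def distrib_right sum.distrib if_distrib[of "\<lambda>c. c * _"] cong: if_cong)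
  moreover have "psi q t m h s x = m * x ^ (q ^ s) - m * h2 * x ^ (q ^ e2) + x ^ (q ^ e3) + h4 * x ^ (q ^ e4)" for x
    unfolding psi_def h2_def[symmetric] h4_def[symmetric] m2[symmetric] m3[symmetric] m4[symmetric] period
    by (simp add: algebra_simps)
  moreover have "a i \<noteq> 0 \<longleftrightarrow> sym_residue t s i" if "i < 2 * t" for i
  proof -
    have "a i \<noteq> 0 \<longleftrightarrow> i \<in> {s, e2, e3, e4}"
      using dist m nz by (auto simp: a_def)
    also have "\<dots> \<longleftrightarrow> sym_residue t s i"
    proof
      assume "i \<in> {s, e2, e3, e4}"
      then show "sym_residue t s i"
        using s by (auto simp: e2_def e3_def e4_def sym_residue_def of_nat_diff split: if_splits)
    next
      assume "sym_residue t s i"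
      then consider (minus) z where "int i - int s = int t * z" | (plus) z where "int i + int s = int t * z"
        unfolding sym_residue_def by (blast elim: dvdE)
      then show "i \<in> {s, e2, e3, e4}"
      proof cases
        case minus
        have "int t * z < int t * 2" "int t * (-2) < int t * z" using minus that lt s by linarith+
        then have "z < 2" "-2 < z" using t by (simp_all only: mult_less_cancel_left)
        then have "z = -1 \<or> z = 0 \<or> z = 1" by linarith
        then show ?thesis using minus lt that by (auto simp: e2_def)
      next
        case plus
        have "int t * z < int t * 4" "int t * 0 < int t * z" using plus that lt s by linarith+
        then have "z < 4" "0 < z" using t by (simp_all only: mult_less_cancel_left)
        then have "z = 1 \<or> z = 2 \<or> z = 3" by linarith
        then have "int i + int s = int t \<or> int i + int s = 2 * int t \<or> int i + int s = 3 * int t"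
          using plus by (auto simp: mult.commute)
        then have "i + s = t \<or> i + s = 2 * t \<or> i + s = 3 * t" by linarith
        moreover have "s < t" "i = t - s" if "i + s = t" using that ne by linarith+
        moreover have "\<not> s < t" "i = 3 * t - s" if "i + s = 3 * t" using that \<open>i < 2 * t\<close> by linarith+
        ultimately have "i = e3 \<or> i = e4" unfolding e3_def e4_def by (metis add_diff_cancel_right')
        then show ?thesis by blast
      qed
    qed
    finally show ?thesis .
  qed
  ultimately show ?thesis by (intro exI[of _ a]) simp
qed

section \<open>Canonical subgeometries\<close>

definition Fq_span :: "nat \<Rightarrow> ('a::field ^ 'r) set \<Rightarrow> ('a ^ 'r) set" where
  "Fq_span q B = {\<Sum>b\<in>B. c b *s b | c. c ` B \<subseteq> Fq q}"

lemma Fq_basis_iff: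
  "Fq_basis q U B \<longleftrightarrow> finite B \<and> U = Fq_span q B \<and>
     (\<forall>c. c ` B \<subseteq> Fq q \<and> (\<Sum>b\<in>B. c b *s b) = 0 \<longrightarrow> (\<forall>b\<in>B. c b = 0))"
  by (simp add: Fq_basis_def Fq_span_def)

context finite_field_extension
begin

lemma Fq_span_subset:
  fixes U :: "('a ^ 'r) set"
  assumes U: "Fq_subspace q U" and "finite B" "B \<subseteq> U"
  shows "Fq_span q B \<subseteq> U"
proof
  fix u assume "u \<in> Fq_span q B"
  then obtain c where c: "c ` B \<subseteq> Fq q" "u = (\<Sum>b\<in>B. c b *s b)" unfolding Fq_span_def by blast
  have "(\<Sum>b\<in>B. c b *s b) \<in> U" using \<open>finite B\<close> \<open>B \<subseteq> U\<close> c(1)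
  proof (induction B)
    case empty
    then show ?case using U by (simp add: Fq_subspace_def)
  next
    case (insert b B)
    then have "c b *s b \<in> U" "(\<Sum>b\<in>B. c b *s b) \<in> U" using U by (auto simp: Fq_subspace_def)
    then show ?case using insert(1,2) U by (simp add: Fq_subspace_def)
  qed
  with c show "u \<in> U" by simp
qed

text \<open>
  A spanning subset of least cardinality is independent: a nontrivial relation would express one of
  its elements by the others.
\<close>

lemma exists_Fq_basis:
  fixes U :: "('a ^ 'r) set"
  assumes U: "Fq_subspace q U"
  shows "\<exists>B. Fq_basis q U B"
proof -
  have fin: "finite B" for B :: "('a ^ 'r) set" by simp
  have "Fq_span q U = U"
  proof (rule antisym[OF Fq_span_subset[OF U fin subset_refl]])
    show "U \<subseteq> Fq_span q U"
    proof
      fix u assume u: "u \<in> U"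
      have "(\<Sum>b\<in>U. (if b = u then 1 else 0) *s b) = (\<Sum>b\<in>U. if b = u then b else 0)"
        by (intro sum.cong) auto
      also have "\<dots> = u" using u by simp
      finally have "u = (\<Sum>b\<in>U. (if b = u then 1 else 0) *s b)" by simp
      moreover have "(\<lambda>b. if b = u then 1 else 0) ` U \<subseteq> (Fq q :: 'a set)"
        using q_ge_2 by (intro image_subsetI) (simp add: zero_in_Fq one_in_Fq)
      ultimately show "u \<in> Fq_span q U" unfolding Fq_span_def mem_Collect_eq by (intro exI conjI)
    qed
  qed
  then have "U \<subseteq> U \<and> Fq_span q U = U" by simp
  from ex_has_least_nat[where P = "\<lambda>B. B \<subseteq> U \<and> Fq_span q B = U" and m = card, OF this]
  obtain B where B: "B \<subseteq> U" "Fq_span q B = U"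
    and min: "\<And>B'. B' \<subseteq> U \<Longrightarrow> Fq_span q B' = U \<Longrightarrow> card B \<le> card B'"
    by (elim exE conjE) simp
  have indep: "c b0 = 0" if c: "c ` B \<subseteq> Fq q" "(\<Sum>b\<in>B. c b *s b) = 0" and b0: "b0 \<in> B" for c b0
  proof (rule ccontr)
    assume nz: "c b0 \<noteq> 0"
    have "Fq_span q (B - {b0}) = U"
    proof (rule antisym)
      show "Fq_span q (B - {b0}) \<subseteq> U" using Fq_span_subset[OF U fin] B(1) by blast
      show "U \<subseteq> Fq_span q (B - {b0})"
      proof
        fix u assume "u \<in> U"
        with B(2) obtain e where e: "e ` B \<subseteq> Fq q" "u = (\<Sum>b\<in>B. e b *s b)" unfolding Fq_span_def by blast
        define k where "k = e b0 / c b0"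
        define e' where "e' b = e b + - (k * c b)" for b
        have k: "k \<in> Fq q" using e c b0 by (auto simp: k_def intro: Fq_divide)
        have "e' ` (B - {b0}) \<subseteq> Fq q"
          using e c k by (auto simp: e'_def simp del: add_uminus_conv_diff intro!: Fq_add Fq_uminus Fq_mult)
        moreover have "u = (\<Sum>b\<in>B - {b0}. e' b *s b)"
        proof -
          have "(\<Sum>b\<in>B. e' b *s b) = u - k *s (\<Sum>b\<in>B. c b *s b)"
            by (simp add: e'_def e(2) vec.scale_left_diff_distrib sum_subtractf vec.scale_sum_right)
          then have "(\<Sum>b\<in>B. e' b *s b) = u" by (simp only: c(2)) simp
          moreover have "e' b0 = 0" using nz by (simp add: e'_def k_def)
          ultimately show ?thesis by (simp add: sum.remove[OF fin b0])
        qed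
        ultimately show "u \<in> Fq_span q (B - {b0})"
          unfolding Fq_span_def mem_Collect_eq by (intro exI conjI)
      qed
    qed
    then have "card B \<le> card (B - {b0})" using min B(1) by blast
    then show False using card_Diff1_less[OF fin b0] by simp
  qed
  have "Fq_basis q U B"
    unfolding Fq_basis_iff
  proof (intro conjI allI impI ballI)
    show "finite B" by (rule fin)
    show "U = Fq_span q B" by (rule B(2)[symmetric])
  qed (elim conjE, rule indep)
  then show ?thesis ..
qed

text \<open>
  Since \<open>\<Sigma>\<close> spans the whole space, the \<open>CARD('r)\<close> elements of an \<open>Fq q\<close>-basis of the underlying subspace
  span it over the field as well, and so they are a basis of it.
\<close>

lemma canonical_subgeometry_basis:
  fixes \<Sigma> :: "('a ^ 'r) set set"
  assumes "canonical_subgeometry q \<Sigma>"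
  shows "\<exists>B. card B = CARD('r) \<and> vec.independent B \<and> vec.span B = UNIV \<and> \<Sigma> = linear_set (Fq_span q B)"
proof -
  obtain U where U: "Fq_subspace q U" "Fq_dim q U = CARD('r)" "\<Sigma> = linear_set U" "vec.span (\<Union>\<Sigma>) = UNIV"
    using assms unfolding canonical_subgeometry_def by blast
  define B where "B = (SOME B. Fq_basis q U B)"
  have "Fq_basis q U B" unfolding B_def using exists_Fq_basis[OF U(1)] by (rule someI_ex)
  then have B: "finite B" "U = Fq_span q B" by (simp_all add: Fq_basis_iff)
  have card: "card B = CARD('r)" using U(2) by (simp add: Fq_dim_def B_def)
  have "U \<subseteq> vec.span B"
  proof
    fix u assume "u \<in> U"
    then obtain c where "u = (\<Sum>b\<in>B. c b *s b)" unfolding B(2) Fq_span_def by blast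
    then show "u \<in> vec.span B" by (simp add: vec.span_sum vec.span_scale vec.span_base)
  qed
  then have "vec.span {u} \<subseteq> vec.span B" if "u \<in> U" for u
    using that by (intro vec.span_minimal) auto
  then have "\<Union>\<Sigma> \<subseteq> vec.span B" unfolding U(3) linear_set_def by blast
  then have "vec.span (\<Union>\<Sigma>) \<subseteq> vec.span B" by (rule vec.span_minimal) simp
  then have span: "vec.span B = UNIV" using U(4) by blast
  have "vec.independent B"
    by (rule vec.card_le_dim_spanning[of B UNIV]) (use B(1) span card in \<open>auto simp: card_cart_basis\<close>)
  with card span B(2) U(3) show ?thesis by blast
qed

lemma card_Fq_span_ge:
  fixes B :: "('a ^ 'r) set"
  assumes "vec.independent B"
  shows "q ^ card B \<le> card (Fq_span q B)"
proof -
  define comb where "comb c = (\<Sum>b\<in>B. c b *s b)" for c :: "'a ^ 'r \<Rightarrow> 'a"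
  have fin: "finite B" by simp
  have "inj_on comb (B \<rightarrow>\<^sub>E Fq q)"
  proof (rule inj_onI)
    fix c c' assume c: "c \<in> B \<rightarrow>\<^sub>E Fq q" "c' \<in> B \<rightarrow>\<^sub>E Fq q" "comb c = comb c'"
    have "(\<Sum>b\<in>B. (c b - c' b) *s b) = 0"
      using c(3) by (simp add: comb_def vec.scale_left_diff_distrib sum_subtractf)
    then have "c b = c' b" if "b \<in> B" for b
      using vec.independentD[OF assms fin subset_refl, of "\<lambda>b. c b - c' b"] that by simp
    then show "c = c'" by (rule PiE_ext[OF c(1,2)])
  qed
  moreover have "comb ` (B \<rightarrow>\<^sub>E Fq q) \<subseteq> Fq_span q B" unfolding comb_def Fq_span_def by blast
  ultimately have "card (B \<rightarrow>\<^sub>E (Fq q :: 'a set)) \<le> card (Fq_span q B)"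
    by (intro card_inj_on_le[of comb]) simp_all
  moreover have "q ^ card B \<le> card (Fq q :: 'a set) ^ card B" by (rule power_mono) (simp_all add: card_Fq_ge)
  ultimately show ?thesis using card_PiE[OF fin, of "\<lambda>_. Fq q :: 'a set"] by simp
qed

end

section \<open>Semilinear maps\<close>

lemma
  assumes "field_automorphism \<theta>"
  shows field_automorphism_add: "\<theta> (a + b) = \<theta> a + \<theta> b"
    and field_automorphism_mult: "\<theta> (a * b) = \<theta> a * \<theta> b"
    and field_automorphism_inj: "inj \<theta>"
    and field_automorphism_surj: "surj \<theta>"
  using assms by (auto simp: field_automorphism_def bij_is_inj bij_is_surj)

lemma field_automorphism_zero: "field_automorphism \<theta> \<Longrightarrow> \<theta> 0 = 0"
  by (metis add_0 add_cancel_right_right field_automorphism_add)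

lemma field_automorphism_eq_zero_iff: "field_automorphism \<theta> \<Longrightarrow> \<theta> a = 0 \<longleftrightarrow> a = 0"
  by (metis field_automorphism_inj field_automorphism_zero injD)

lemma field_automorphism_one:
  assumes "field_automorphism \<theta>"
  shows "\<theta> 1 = 1"
proof -
  have "\<theta> 1 * \<theta> 1 = \<theta> 1 * 1" using field_automorphism_mult[OF assms, of 1 1] by simp
  moreover have "\<theta> 1 \<noteq> 0" using field_automorphism_eq_zero_iff[OF assms, of 1] by simp
  ultimately show ?thesis by simp
qed

lemma field_automorphism_power: "field_automorphism \<theta> \<Longrightarrow> \<theta> (a ^ k) = \<theta> a ^ k"
  by (induction k) (simp_all add: field_automorphism_one field_automorphism_mult)

lemma field_automorphism_sum: "field_automorphism \<theta> \<Longrightarrow> \<theta> (\<Sum>j\<in>J. f j) = (\<Sum>j\<in>J. \<theta> (f j))"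
  by (induction J rule: infinite_finite_induct) (simp_all add: field_automorphism_zero field_automorphism_add)

lemma field_automorphism_inv:
  assumes "field_automorphism \<theta>"
  shows "field_automorphism (inv \<theta>)"
  unfolding field_automorphism_def
proof (intro conjI allI)
  have "bij \<theta>" using assms by (simp add: field_automorphism_def)
  then show "bij (inv \<theta>)" by (rule bij_imp_bij_inv)
  note inj = field_automorphism_inj[OF assms] and f_inv = surj_f_inv_f[OF field_automorphism_surj[OF assms]]
  show "inv \<theta> (a + b) = inv \<theta> a + inv \<theta> b" for a b
    by (rule inv_f_eq[OF inj]) (simp add: field_automorphism_add[OF assms] f_inv)
  show "inv \<theta> (a * b) = inv \<theta> a * inv \<theta> b" for a b
    by (rule inv_f_eq[OF inj]) (simp add: field_automorphism_mult[OF assms] f_inv)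
qed

lemma field_automorphism_comp:
  "field_automorphism \<theta> \<Longrightarrow> field_automorphism \<eta> \<Longrightarrow> field_automorphism (\<theta> \<circ> \<eta>)"
  by (simp add: field_automorphism_def bij_comp)

lemma field_automorphism_funpow: "field_automorphism \<theta> \<Longrightarrow> field_automorphism (\<theta> ^^ i)"
proof (induction i)
  case (Suc i)
  then show ?case using field_automorphism_comp[of \<theta> "\<theta> ^^ i"] by (simp add: comp_def)
qed (simp add: field_automorphism_def)

lemma semilinear_zero: "semilinear \<theta> f \<Longrightarrow> f 0 = 0"
  unfolding semilinear_def by (metis add_cancel_right_right add_0)

lemma semilinear_sum:
  assumes "semilinear \<theta> f"
  shows "f (\<Sum>b\<in>B. c b *s b) = (\<Sum>b\<in>B. \<theta> (c b) *s f b)"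
  using assms semilinear_zero[OF assms]
  by (induction B rule: infinite_finite_induct) (simp_all add: semilinear_def)

lemma semilinear_funpow: "semilinear \<theta> f \<Longrightarrow> semilinear (\<theta> ^^ i) (f ^^ i)"
  by (induction i) (simp_all add: semilinear_def)

lemma semilinear_image_subspace:
  assumes f: "semilinear \<theta> f" and \<theta>: "surj \<theta>" and S: "vec.subspace S"
  shows "vec.subspace (f ` S)"
proof (rule vec.subspaceI)
  show "0 \<in> f ` S" using semilinear_zero[OF f] vec.subspace_0[OF S] by force
  fix x y assume "x \<in> f ` S" "y \<in> f ` S"
  then obtain u v where "x = f u" "y = f v" "u \<in> S" "v \<in> S" by blast
  then have "x + y = f (u + v)" "u + v \<in> S" using f vec.subspace_add[OF S] by (simp_all add: semilinear_def)
  then show "x + y \<in> f ` S" by (rule image_eqI)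
next
  fix c x assume "x \<in> f ` S"
  then obtain u where "x = f u" "u \<in> S" by blast
  moreover obtain d where "c = \<theta> d" using \<theta> by (metis surjD)
  ultimately have "c *s x = f (d *s u)" "d *s u \<in> S"
    using f vec.subspace_scale[OF S] by (simp_all add: semilinear_def)
  then show "c *s x \<in> f ` S" by (rule image_eqI)
qed

lemma semilinear_image_span_singleton:
  assumes f: "semilinear \<theta> f" and \<theta>: "surj \<theta>"
  shows "f ` vec.span {v} = vec.span {f v}"
proof -
  have "f ` vec.span {v} = range (\<lambda>k. \<theta> k *s f v)"
    using f by (simp add: vec.span_singleton image_image semilinear_def)
  also have "\<dots> = (\<lambda>k. k *s f v) ` range \<theta>" by (simp add: image_image)
  finally show ?thesis by (simp add: \<theta> vec.span_singleton)
qed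

text \<open>
  The values of \<open>\<sigma>\<close> are prescribed on subspaces only, so the iterates have to be known to stay subspaces.
\<close>

lemma PGammaL_funpow_subspace:
  assumes \<sigma>: "\<And>S. vec.subspace S \<Longrightarrow> \<sigma> S = f ` S" and f: "semilinear \<theta> f" and \<theta>: "surj \<theta>"
    and S: "vec.subspace S"
  shows "(\<sigma> ^^ i) S = (f ^^ i) ` S \<and> vec.subspace ((\<sigma> ^^ i) S)"
proof (induction i)
  case (Suc i)
  then have IH: "(\<sigma> ^^ i) S = (f ^^ i) ` S" "vec.subspace ((\<sigma> ^^ i) S)" by blast+
  have "(\<sigma> ^^ Suc i) S = f ` (\<sigma> ^^ i) S" using \<sigma>[OF IH(2)] by simp
  moreover have "vec.subspace (f ` (\<sigma> ^^ i) S)" using semilinear_image_subspace[OF f \<theta> IH(2)] .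
  ultimately show ?case by (simp add: IH(1) image_image)
qed (use S in simp)

text \<open>
  For distinct \<open>b\<close>, \<open>b'\<close> in \<open>B\<close>, compare coefficients in \<open>f (b + c b') = \<nu> (b + c b')\<close>: for \<open>c = 1\<close> this shows that
  \<open>b\<close> and \<open>b'\<close> are multiplied by the same scalar, and then for all \<open>c\<close> in \<open>Fq q\<close> that \<open>\<theta>\<close> fixes \<open>c\<close>.
\<close>

lemma semilinear_fixing_subgeometry:
  fixes B :: "('a::field ^ 'r) set"
  assumes f: "semilinear \<theta> f" "inj f" and \<theta>: "field_automorphism \<theta>"
    and B: "vec.independent B" "card B \<ge> 2" and q: "q > 0"
    and fix_pts: "\<And>u. u \<in> Fq_span q B \<Longrightarrow> u \<noteq> 0 \<Longrightarrow> f ` vec.span {u} = vec.span {u}"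
  shows "\<exists>\<mu>. \<mu> \<noteq> 0 \<and> (\<forall>b\<in>B. f b = \<mu> *s b)" and "c \<in> Fq q \<Longrightarrow> \<theta> c = c"
proof -
  have finB: "finite B" using B(2) by (metis card.infinite not_numeral_le_zero)
  have pair: "x = x' \<and> y = y'" if "b \<in> B" "b' \<in> B" "b \<noteq> b'" "x *s b + y *s b' = x' *s b + y' *s b'"
    for b b' x y x' y'
  proof -
    define k where "k v = (if v = b then x - x' else y - y')" for v
    have "(\<Sum>v\<in>{b, b'}. k v *s v) = 0"
      using that by (simp add: k_def vec.scale_left_diff_distrib algebra_simps)
    from vec.independentD[OF B(1) _ _ this] that have "k b = 0" "k b' = 0" by auto
    then show ?thesis using that(3) by (simp_all add: k_def)
  qed
  have two_in: "b + c *s b' \<in> Fq_span q B" if "b \<in> B" "b' \<in> B" "b \<noteq> b'" "c \<in> Fq q" for b b' c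
  proof -
    define k where "k v = (if v = b then 1 else if v = b' then c else 0)" for v
    have "(\<Sum>v\<in>B. k v *s v) = (\<Sum>v\<in>B. (if v = b then v else 0) + (if v = b' then c *s v else 0))"
      using that by (intro sum.cong) (auto simp: k_def)
    also have "\<dots> = b + c *s b'" using that finB by (simp add: sum.distrib)
    finally have "b + c *s b' = (\<Sum>v\<in>B. k v *s v)" by simp
    moreover have "k ` B \<subseteq> Fq q" using that q by (auto simp: k_def zero_in_Fq one_in_Fq)
    ultimately show ?thesis unfolding Fq_span_def mem_Collect_eq by (intro exI conjI)
  qed
  have eigen: "\<exists>\<mu>. f u = \<mu> *s u" if "u \<in> Fq_span q B" for u
  proof (cases "u = 0")
    case False
    have "f u \<in> vec.span {u}" using fix_pts[OF that False] vec.span_base[of u "{u}"] by blast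
    then show ?thesis by (auto simp: vec.span_singleton)
  qed (simp add: semilinear_zero[OF f(1)])
  have key: "\<exists>\<mu>. f b = \<mu> *s b \<and> f b' = \<mu> *s b' \<and> (\<forall>c\<in>Fq q. \<mu> * \<theta> c = \<mu> * c)"
    if bb: "b \<in> B" "b' \<in> B" "b \<noteq> b'" for b b'
  proof -
    have "0 \<in> Fq q" "1 \<in> Fq q" using q by (auto simp: zero_in_Fq one_in_Fq)
    obtain \<mu> where \<mu>: "f b = \<mu> *s b" using eigen[OF two_in[OF bb \<open>0 \<in> Fq q\<close>]] by auto
    obtain \<mu>' where \<mu>': "f b' = \<mu>' *s b'" using eigen[OF two_in[of b' b 0]] bb \<open>0 \<in> Fq q\<close> by auto
    have *: "\<mu>' * \<theta> c = \<mu> * c" if "c \<in> Fq q" for c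
    proof -
      obtain \<nu> where "f (b + c *s b') = \<nu> *s (b + c *s b')" using eigen[OF two_in[OF bb \<open>c \<in> Fq q\<close>]] by blast
      then have "\<mu> *s b + (\<theta> c * \<mu>') *s b' = \<nu> *s b + (\<nu> * c) *s b'"
        using f(1) by (simp add: semilinear_def \<mu> \<mu>' vec.scale_right_distrib)
      from pair[OF bb this] show ?thesis by (simp add: mult.commute)
    qed
    have "\<theta> 1 = 1" by (rule field_automorphism_one[OF \<theta>])
    then have "\<mu>' = \<mu>" using *[OF \<open>1 \<in> Fq q\<close>] by simp
    with \<mu> \<mu>' * show ?thesis by blast
  qed
  obtain b0 where b0: "b0 \<in> B" using B(2) by fastforce
  have "B \<noteq> {b0}" using B(2) by auto
  then obtain b1 where b1: "b1 \<in> B" "b1 \<noteq> b0" using b0 by blast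
  obtain \<mu> where \<mu>: "f b0 = \<mu> *s b0" "f b1 = \<mu> *s b1" "\<forall>c\<in>Fq q. \<mu> * \<theta> c = \<mu> * c"
    using key[OF b0 b1(1)] b1(2) by blast
  have nz: "b \<noteq> 0" if "b \<in> B" for b using B(1) that vec.dependent_zero by blast
  have \<mu>nz: "\<mu> \<noteq> 0"
  proof
    assume "\<mu> = 0"
    then have "f b0 = f 0" using \<mu>(1) by (simp add: semilinear_zero[OF f(1)])
    then show False using f(2) nz[OF b0] by (meson injD)
  qed
  have "f b = \<mu> *s b" if bB: "b \<in> B" for b
  proof (cases "b = b0")
    case False
    obtain \<nu> where \<nu>: "f b0 = \<nu> *s b0" "f b = \<nu> *s b" using key[OF b0 bB] False by blast
    then have "\<nu> = \<mu>" using \<mu>(1) nz[OF b0] by (simp add: vec.scale_cancel_right)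
    with \<nu> show ?thesis by simp
  qed (use \<mu> in simp)
  with \<mu>nz show "\<exists>\<mu>. \<mu> \<noteq> 0 \<and> (\<forall>b\<in>B. f b = \<mu> *s b)" by blast
  show "\<theta> c = c" if "c \<in> Fq q" using \<mu>(3) that \<mu>nz by simp
qed

lemma funpow_eigen:
  assumes f: "semilinear \<theta> f" and B: "\<forall>b\<in>B. f b = \<mu> *s b" and \<mu>: "\<mu> \<noteq> (0::'a::field)"
    and \<theta>: "field_automorphism \<theta>"
  shows "\<exists>\<nu>. \<nu> \<noteq> 0 \<and> (\<forall>b\<in>B. (f ^^ i) b = \<nu> *s b)"
proof (induction i)
  case 0
  show ?case by (intro exI[of _ 1]) simp
next
  case (Suc i)
  then obtain \<nu> where \<nu>: "\<nu> \<noteq> 0" "\<forall>b\<in>B. (f ^^ i) b = \<nu> *s b" by blast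
  have "\<theta> \<nu> \<noteq> 0" using \<nu>(1) by (simp add: field_automorphism_eq_zero_iff[OF \<theta>])
  moreover have "(f ^^ Suc i) b = (\<theta> \<nu> * \<mu>) *s b" if "b \<in> B" for b
    using \<nu>(2) B f that by (simp add: semilinear_def)
  ultimately show ?case using \<mu> by (metis mult_eq_0_iff)
qed

section \<open>The vertex as a common kernel\<close>

text \<open>
  Linearly independent functionals have a dual family of vectors. In the inductive step the new
  functional differs from its combination of the old ones somewhere, say at \<open>z\<close>; subtracting
  from \<open>z\<close> its components along the old dual vectors gives a vector that only the new functional sees.
\<close>

lemma dual_family_exists:
  fixes L :: "'j \<Rightarrow> 'a::field ^ 'n \<Rightarrow> 'a"
  assumes J: "finite J"
    and add: "\<And>j u v. L j (u + v) = L j u + L j v" and scale: "\<And>j k v. L j (k *s v) = k * L j v"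
    and indep: "\<And>C j. (\<And>v. (\<Sum>j\<in>J. C j * L j v) = 0) \<Longrightarrow> j \<in> J \<Longrightarrow> C j = 0"
  shows "\<exists>w. \<forall>i\<in>J. \<forall>j\<in>J. L i (w j) = (if i = j then 1 else 0)"
  using J indep
proof (induction J)
  case (insert a J)
  have sub: "L j (u - v) = L j u - L j v" for j u v
    using add[of j "u - v" v] by (simp add: algebra_simps)
  have zero: "L j 0 = 0" for j using sub[of j 0 0] by simp
  have sum: "L j (\<Sum>i\<in>I. c i *s w i) = (\<Sum>i\<in>I. c i * L j (w i))" for j I c and w :: "'j \<Rightarrow> 'a ^ 'n"
    by (induction I rule: infinite_finite_induct) (simp_all add: add scale zero)
  have "C j = 0" if "\<And>v. (\<Sum>j\<in>J. C j * L j v) = 0" "j \<in> J" for C j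
  proof -
    have "(\<Sum>j\<in>insert a J. (if j = a then 0 else C j) * L j v) = 0" for v
    proof -
      have "(\<Sum>j\<in>J. (if j = a then 0 else C j) * L j v) = (\<Sum>j\<in>J. C j * L j v)"
        using insert(2) by (intro sum.cong) auto
      then show ?thesis unfolding sum.insert[OF insert(1,2)] using that(1)[of v] by simp
    qed
    from insert.prems[OF this, of j] that(2) insert(2) show ?thesis by (auto split: if_splits)
  qed
  with insert.IH obtain w where w: "\<forall>i\<in>J. \<forall>j\<in>J. L i (w j) = (if i = j then 1 else 0)" by blast
  have "\<exists>z. L a z - (\<Sum>j\<in>J. L a (w j) * L j z) \<noteq> 0"
  proof (rule ccontr)
    assume "\<not> ?thesis"
    then have none: "L a z - (\<Sum>j\<in>J. L a (w j) * L j z) = 0" for z by blast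
    have "(\<Sum>j\<in>insert a J. (if j = a then 1 else - L a (w j)) * L j v) = 0" for v
    proof -
      have "(\<Sum>j\<in>J. (if j = a then 1 else - L a (w j)) * L j v) = - (\<Sum>j\<in>J. L a (w j) * L j v)"
        unfolding sum_negf[symmetric] using insert(2) by (intro sum.cong) auto
      then show ?thesis unfolding sum.insert[OF insert(1,2)] using none[of v] by simp
    qed
    from insert.prems[OF this, of a] show False by simp
  qed
  then obtain z where z: "L a z - (\<Sum>j\<in>J. L a (w j) * L j z) \<noteq> 0" by blast
  define y where "y = z - (\<Sum>j\<in>J. L j z *s w j)"
  have y_a: "L a y \<noteq> 0" using z by (simp add: y_def sub sum mult.commute)
  have y_J: "L i y = 0" if "i \<in> J" for i
  proof -
    have "(\<Sum>j\<in>J. L j z * L i (w j)) = (\<Sum>j\<in>J. if j = i then L j z else 0)"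
      using w that by (intro sum.cong) auto
    then show ?thesis using that insert(1) by (simp add: y_def sub sum)
  qed
  define y' where "y' = (1 / L a y) *s y"
  have y': "L a y' = 1" "\<And>i. i \<in> J \<Longrightarrow> L i y' = 0" using y_a y_J by (simp_all add: y'_def scale)
  define w' where "w' j = (if j = a then y' else w j - L a (w j) *s y')" for j
  have "L i (w' j) = (if i = j then 1 else 0)" if "i \<in> insert a J" "j \<in> insert a J" for i j
    using that w y' insert(2) by (auto simp: w'_def sub scale)
  then show ?case by blast
qed simp

text \<open>
  Adding the functionals one at a time, each one cuts down the common kernel properly, as its dual
  vector lies in the kernel of the others.
\<close>

lemma dim_common_kernel:
  fixes L :: "'j \<Rightarrow> 'a::field ^ 'n \<Rightarrow> 'a"
  assumes J: "finite J"
    and add: "\<And>j u v. L j (u + v) = L j u + L j v" and scale: "\<And>j k v. L j (k *s v) = k * L j v"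
    and indep: "\<And>C j. (\<And>v. (\<Sum>j\<in>J. C j * L j v) = 0) \<Longrightarrow> j \<in> J \<Longrightarrow> C j = 0"
  shows "vec.dim {v. \<forall>j\<in>J. L j v = 0} + card J \<le> CARD('n)"
proof -
  obtain w where w: "\<forall>i\<in>J. \<forall>j\<in>J. L i (w j) = (if i = j then 1 else 0)"
    using dual_family_exists[of J L] assms by blast
  have zero: "L j 0 = 0" for j using add[of j 0 0] by (metis add_0 add_cancel_right_right)
  have sub: "vec.subspace {v. \<forall>j\<in>I. L j v = 0}" for I
    by (rule vec.subspaceI) (auto simp: add scale zero)
  then have span_K: "vec.span {v. \<forall>j\<in>I. L j v = 0} = {v. \<forall>j\<in>I. L j v = 0}" for I
    by (simp only: vec.span_eq_iff)
  have "vec.dim {v. \<forall>j\<in>I. L j v = 0} + card I \<le> CARD('n)" if "finite I" "I \<subseteq> J" for I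
    using that
  proof (induction I)
    case empty
    then show ?case by (simp add: card_cart_basis)
  next
    case (insert a I)
    have "w a \<in> {v. \<forall>j\<in>I. L j v = 0} - {v. \<forall>j\<in>insert a I. L j v = 0}" using w insert by auto
    then have "{v. \<forall>j\<in>insert a I. L j v = 0} \<subset> {v. \<forall>j\<in>I. L j v = 0}" by auto
    then have "vec.span {v. \<forall>j\<in>insert a I. L j v = 0} \<subset> vec.span {v. \<forall>j\<in>I. L j v = 0}"
      unfolding span_K .
    from vec.dim_psubset[OF this] show ?case using insert by simp
  qed
  from this[OF J subset_refl] show ?thesis .
qed

text \<open>
  The projection from \<open>\<Gamma>\<close> onto \<open>\<Lambda>\<close> is induced by the linear projection along the decomposition of the
  space as the direct sum of \<open>\<Gamma>\<close> and \<open>\<Lambda>\<close>. Composed with the coordinates on \<open>\<Lambda>\<close>, it presents \<open>\<Gamma>\<close> as the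
  kernel of a linear map onto the plane.
\<close>

lemma projection_coordinates:
  fixes \<Gamma> \<Lambda> :: "('a::field ^ 'n) set"
  assumes \<Gamma>: "proj_subspace (int CARD('n) - 3) \<Gamma>" and \<Lambda>: "proj_subspace 1 \<Lambda>"
    and disj: "\<Gamma> \<inter> \<Lambda> = {0}" and \<iota>: "line_coordinates \<Lambda> \<iota>"
  shows "\<exists>\<pi>. (\<forall>u v. \<pi> (u + v) = \<pi> u + \<pi> v) \<and> (\<forall>c v. \<pi> (c *s v) = c *s \<pi> v) \<and>
             {v. \<pi> v = 0} = \<Gamma> \<and> (\<forall>u. \<iota> ` (vec.span (\<Gamma> \<union> vec.span {u}) \<inter> \<Lambda>) = vec.span {\<pi> u})"
proof -
  have sG: "vec.subspace \<Gamma>" and dG: "int (vec.dim \<Gamma>) = int CARD('n) - 2"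
    and sL: "vec.subspace \<Lambda>" and dL: "vec.dim \<Lambda> = 2"
    using \<Gamma> \<Lambda> by (auto simp: proj_subspace_def pdim_def)
  have spanG: "vec.span \<Gamma> = \<Gamma>" using sG by simp
  have lin: "Vector_Spaces.linear (*s) (*s) \<iota>" and bij: "bij_betw \<iota> \<Lambda> UNIV"
    using \<iota> by (auto simp: line_coordinates_def)
  note \<iota>_add = vec.linear_add[OF lin] and \<iota>_scale = vec.linear_scale[OF lin] and \<iota>_0 = vec.linear_0[OF lin]
  obtain D where D: "D \<subseteq> \<Lambda>" "vec.independent D" "\<Lambda> \<subseteq> vec.span D" "card D = 2"
    using vec.basis_exists[of \<Lambda>] dL by metis
  then obtain w1 w2 where w: "D = {w1, w2}" "w1 \<noteq> w2" by (meson card_2_iff)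
  have wL: "w1 \<in> \<Lambda>" "w2 \<in> \<Lambda>" using D w by auto
  have w1: "w1 \<notin> vec.span \<Gamma>"
  proof
    assume "w1 \<in> vec.span \<Gamma>"
    then have "w1 = 0" using wL disj by (auto simp: spanG)
    then show False using D(2) w vec.dependent_zero by blast
  qed
  have w2: "w2 \<notin> vec.span (insert w1 \<Gamma>)"
  proof
    assume "w2 \<in> vec.span (insert w1 \<Gamma>)"
    then obtain k where "w2 - k *s w1 \<in> \<Gamma>" by (auto simp: vec.span_breakdown_eq spanG)
    moreover have "w2 - k *s w1 \<in> \<Lambda>" using wL sL by (intro vec.subspace_diff vec.subspace_scale)
    ultimately have "w2 - k *s w1 = 0" using disj by blast
    then have "w2 \<in> vec.span {w1}" by (auto simp: vec.span_singleton)
    moreover have "{w1, w2} - {w2} = {w1}" using w(2) by auto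
    ultimately show False using D(2) w by (metis insertCI vec.dependent_def)
  qed
  have "vec.dim (insert w2 (insert w1 \<Gamma>)) = CARD('n)"
    using w1 w2 dG by (simp add: vec.dim_insert)
  then have "vec.span (insert w2 (insert w1 \<Gamma>)) = UNIV"
    using vec.dim_eq_full[of "insert w2 (insert w1 \<Gamma>)"] by (simp add: vec.dimension_def card_cart_basis)
  have ex: "\<exists>w. w \<in> \<Lambda> \<and> v - w \<in> \<Gamma>" for v
  proof -
    have "v \<in> vec.span (insert w2 (insert w1 \<Gamma>))" using \<open>_ = UNIV\<close> by simp
    then obtain k2 k1 where "v - k2 *s w2 - k1 *s w1 \<in> \<Gamma>"
      by (auto simp: vec.span_breakdown_eq spanG)
    then have "v - (k2 *s w2 + k1 *s w1) \<in> \<Gamma>" by (simp add: diff_diff_eq)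
    moreover have "k2 *s w2 + k1 *s w1 \<in> \<Lambda>" using wL sL by (intro vec.subspace_add vec.subspace_scale)
    ultimately show ?thesis by blast
  qed
  define p where "p v = (SOME w. w \<in> \<Lambda> \<and> v - w \<in> \<Gamma>)" for v
  have p: "p v \<in> \<Lambda>" "v - p v \<in> \<Gamma>" for v
    using someI_ex[OF ex[of v]] by (auto simp: p_def)
  have p_eq: "p v = w" if "w \<in> \<Lambda>" "v - w \<in> \<Gamma>" for v w
  proof -
    have "(v - w) - (v - p v) \<in> \<Gamma>" using vec.subspace_diff[OF sG that(2) p(2)] .
    moreover have "p v - w \<in> \<Lambda>" using vec.subspace_diff[OF sL p(1) that(1)] .
    ultimately have "p v - w \<in> \<Gamma> \<inter> \<Lambda>" by simp
    then show ?thesis using disj by simp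
  qed
  have p_add: "p (u + v) = p u + p v" for u v
  proof (rule p_eq)
    show "p u + p v \<in> \<Lambda>" using p sL by (intro vec.subspace_add)
    have "(u - p u) + (v - p v) \<in> \<Gamma>" using p sG by (intro vec.subspace_add)
    then show "u + v - (p u + p v) \<in> \<Gamma>" by (simp add: algebra_simps)
  qed
  have p_scale: "p (c *s v) = c *s p v" for c v
  proof (rule p_eq)
    show "c *s p v \<in> \<Lambda>" using p sL by (intro vec.subspace_scale)
    have "c *s (v - p v) \<in> \<Gamma>" using p sG by (intro vec.subspace_scale)
    then show "c *s v - c *s p v \<in> \<Gamma>" by (simp add: vec.scale_right_diff_distrib)
  qed
  have p_ker: "p v = 0 \<longleftrightarrow> v \<in> \<Gamma>" for v
    using p(2)[of v] p_eq[of 0 v] vec.subspace_0[OF sL] by auto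
  have p_id: "p w = w" if "w \<in> \<Lambda>" for w using p_eq[of w w] that vec.subspace_0[OF sG] by simp
  define \<pi> where "\<pi> v = \<iota> (p v)" for v
  have "\<pi> v = 0 \<longleftrightarrow> v \<in> \<Gamma>" for v
    using bij p(1)[of v] vec.subspace_0[OF sL] \<iota>_0 p_ker[of v]
    unfolding \<pi>_def bij_betw_def inj_on_def by metis
  moreover have "\<iota> ` (vec.span (\<Gamma> \<union> vec.span {u}) \<inter> \<Lambda>) = vec.span {\<pi> u}" for u
  proof -
    have "vec.span (\<Gamma> \<union> vec.span {u}) \<inter> \<Lambda> = vec.span {p u}"
    proof (intro equalityI subsetI)
      fix x assume x: "x \<in> vec.span (\<Gamma> \<union> vec.span {u}) \<inter> \<Lambda>"
      then obtain g k where gk: "x = g + k *s u" "g \<in> \<Gamma>"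
        unfolding vec.span_Un vec.span_span spanG by (auto simp: vec.span_singleton)
      have "p x = k *s p u" using gk p_ker[of g] by (simp add: p_add p_scale)
      then show "x \<in> vec.span {p u}" using p_id x by (auto simp: vec.span_singleton)
    next
      fix x assume "x \<in> vec.span {p u}"
      then obtain k where k: "x = k *s p u" by (auto simp: vec.span_singleton)
      have "u \<in> vec.span (\<Gamma> \<union> vec.span {u})" "u - p u \<in> vec.span (\<Gamma> \<union> vec.span {u})"
        using p(2)[of u] by (auto intro!: vec.span_base)
      then have "u - (u - p u) \<in> vec.span (\<Gamma> \<union> vec.span {u})" by (rule vec.span_diff)
      then show "x \<in> vec.span (\<Gamma> \<union> vec.span {u}) \<inter> \<Lambda>"
        using k p(1) sL by (auto intro: vec.span_scale vec.subspace_scale)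
    qed
    then show ?thesis by (auto simp: vec.span_singleton \<pi>_def \<iota>_scale image_iff)
  qed
  ultimately show ?thesis
    by (intro exI[of _ \<pi>]) (auto simp: \<pi>_def p_add p_scale \<iota>_add \<iota>_scale)
qed

text \<open>
  The components of \<open>\<pi>\<close> are two linear functionals with common kernel \<open>\<Gamma>\<close>. The functionals that
  take the values \<open>(\<theta> ^^ i) (\<pi> b $ k)\<close> on the basis \<open>B\<close>, which \<open>f\<close> scales, vanish on \<open>(f ^^ i) ` \<Gamma>\<close>; so
  the intersection of the first \<open>\<gamma> + 1\<close> images has the least possible dimension as soon as these
  \<open>2 * (\<gamma> + 1)\<close> functionals are independent.
\<close>

lemma dim_shifted_intersection:
  fixes \<pi> :: "'a::field ^ 'n \<Rightarrow> 'a ^ 2"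
  assumes add: "\<And>u v. \<pi> (u + v) = \<pi> u + \<pi> v" and scale: "\<And>c v. \<pi> (c *s v) = c *s \<pi> v"
    and B: "vec.independent B" "vec.span B = UNIV"
    and f: "semilinear \<theta> f" and \<theta>: "field_automorphism \<theta>" and fB: "\<forall>b\<in>B. f b = \<mu> *s b" "\<mu> \<noteq> 0"
    and indep: "\<And>C i k. \<forall>b\<in>B. (\<Sum>i\<le>\<gamma>. \<Sum>k\<in>UNIV. C i k * (\<theta> ^^ i) (\<pi> b $ k)) = 0 \<Longrightarrow> i \<le> \<gamma> \<Longrightarrow> C i k = 0"
  shows "vec.dim (\<Inter>i\<in>{..\<gamma>}. (f ^^ i) ` {v. \<pi> v = 0}) + 2 * (\<gamma> + 1) \<le> CARD('n)"
proof -
  have finB: "finite B" using B(1) by (rule vec.finiteI_independent)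
  have "\<exists>g. Vector_Spaces.linear (*s) (*s) g \<and> (\<forall>b\<in>B. g b = (\<chi> k. (\<theta> ^^ i) (\<pi> b $ k)))" for i
    by (rule vec.linear_independent_extend[OF B(1)])
  then obtain g where lin: "\<And>i. Vector_Spaces.linear (*s) (*s) (g i)"
    and gB: "\<And>i b. b \<in> B \<Longrightarrow> g i b = (\<chi> k. (\<theta> ^^ i) (\<pi> b $ k))"
    by metis
  define L where "L = (\<lambda>(i, k) v. g i v $ k)"
  define J where "J = {..\<gamma>} \<times> (UNIV :: 2 set)"
  have \<pi>0: "\<pi> 0 = 0" using scale[of 0 0] by simp
  have \<pi>_sum: "\<pi> (\<Sum>b\<in>B. c b *s b) = (\<Sum>b\<in>B. c b *s \<pi> b)" for c
    by (induction B rule: infinite_finite_induct) (simp_all add: add scale \<pi>0)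
  have g_sum: "g i (\<Sum>b\<in>B. c b *s b) = (\<Sum>b\<in>B. c b *s g i b)" for i c
    by (simp add: vec.linear_sum[OF lin] vec.linear_scale[OF lin])
  have kernel: "L (i, k) v = 0" if v: "v \<in> (f ^^ i) ` {v. \<pi> v = 0}" for i k v
  proof -
    obtain w where w: "\<pi> w = 0" "v = (f ^^ i) w" using v by blast
    have "w \<in> vec.span B" using B(2) by simp
    then obtain c where c: "w = (\<Sum>b\<in>B. c b *s b)" using vec.span_finite[OF finB] by auto
    obtain \<nu> where \<nu>: "\<forall>b\<in>B. (f ^^ i) b = \<nu> *s b" using funpow_eigen[OF f fB \<theta>] by blast
    note \<theta>i = field_automorphism_funpow[OF \<theta>, of i]
    have "v = (\<Sum>b\<in>B. (\<theta> ^^ i) (c b) *s (f ^^ i) b)"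
      unfolding w(2) c by (rule semilinear_sum[OF semilinear_funpow[OF f]])
    also have "\<dots> = (\<Sum>b\<in>B. ((\<theta> ^^ i) (c b) * \<nu>) *s b)" by (intro sum.cong) (simp_all add: \<nu>)
    finally have "g i v $ k = (\<Sum>b\<in>B. (\<theta> ^^ i) (c b) * \<nu> * (\<theta> ^^ i) (\<pi> b $ k))"
      by (simp add: g_sum gB)
    also have "\<dots> = \<nu> * (\<theta> ^^ i) (\<Sum>b\<in>B. c b * \<pi> b $ k)"
      by (simp add: field_automorphism_sum[OF \<theta>i] field_automorphism_mult[OF \<theta>i] sum_distrib_left mult_ac)
    also have "(\<Sum>b\<in>B. c b * \<pi> b $ k) = \<pi> w $ k" by (simp add: c \<pi>_sum)
    finally show ?thesis using w(1) by (simp add: L_def field_automorphism_zero[OF \<theta>i])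
  qed
  have "C j = 0" if C: "\<And>v. (\<Sum>j\<in>J. C j * L j v) = 0" and j: "j \<in> J" for C j
  proof -
    have "(\<Sum>i\<le>\<gamma>. \<Sum>k\<in>UNIV. C (i, k) * (\<theta> ^^ i) (\<pi> b $ k)) = 0" if b: "b \<in> B" for b
    proof -
      have "(\<Sum>i\<le>\<gamma>. \<Sum>k\<in>UNIV. C (i, k) * (\<theta> ^^ i) (\<pi> b $ k)) = (\<Sum>i\<le>\<gamma>. \<Sum>k\<in>UNIV. C (i, k) * L (i, k) b)"
        by (simp add: L_def gB[OF b])
      also have "\<dots> = (\<Sum>j\<in>J. C j * L j b)"
        unfolding J_def sum.cartesian_product by (intro sum.cong) auto
      finally show ?thesis using C by simp
    qed
    then show ?thesis using indep[of "\<lambda>i k. C (i, k)" "fst j" "snd j"] j by (auto simp: J_def)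
  qed
  then have "vec.dim {v. \<forall>j\<in>J. L j v = 0} + card J \<le> CARD('n)"
    by (intro dim_common_kernel)
       (auto simp: J_def L_def vec.linear_add[OF lin] vec.linear_scale[OF lin])
  moreover have "card J = 2 * (\<gamma> + 1)" by (simp add: J_def card_cartesian_product)
  moreover have "(\<Inter>i\<in>{..\<gamma>}. (f ^^ i) ` {v. \<pi> v = 0}) \<subseteq> {v. \<forall>j\<in>J. L j v = 0}"
    using kernel by (auto simp: J_def)
  then have "vec.dim (\<Inter>i\<in>{..\<gamma>}. (f ^^ i) ` {v. \<pi> v = 0}) \<le> vec.dim {v. \<forall>j\<in>J. L j v = 0}"
    by (rule vec.dim_subset)
  ultimately show ?thesis by linarith
qed

lemma linear_set_parametrized: "linear_set {g x | x. True} = (\<lambda>x. vec.span {g x}) ` {x. g x \<noteq> 0}"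
  unfolding linear_set_def by blast

text \<open>
  The projection and the equivalence with the linear set of \<open>W\<close> are combined into one semilinear map
  \<open>\<omega>\<close> with kernel \<open>\<Gamma>\<close>, so that the projected subgeometry becomes equal to the given linear set.
\<close>

lemma vertex_coordinates:
  fixes \<Gamma> \<Lambda> U :: "('a::field ^ 'n) set" and W :: "('a ^ 2) set"
  assumes \<Gamma>: "proj_subspace (int CARD('n) - 3) \<Gamma>" and \<Lambda>: "proj_subspace 1 \<Lambda>"
    and disj: "\<Gamma> \<inter> \<Lambda> = {0}" and \<iota>: "line_coordinates \<Lambda> \<iota>"
    and equiv: "pg_equivalent ((`) \<iota> ` projection \<Gamma> \<Lambda> (linear_set U)) (linear_set W)"
  shows "\<exists>\<tau> \<omega>. field_automorphism \<tau> \<and> (\<forall>u v. \<omega> (u + v) = \<omega> u + \<omega> v) \<and>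
           (\<forall>c v. \<omega> (c *s v) = \<tau> c *s \<omega> v) \<and> {v. \<omega> v = 0} = \<Gamma> \<and>
           (\<lambda>u. vec.span {\<omega> u}) ` (U - {0}) = linear_set W"
proof -
  obtain \<pi> where \<pi>: "\<And>u v. \<pi> (u + v) = \<pi> u + \<pi> v" "\<And>c v. \<pi> (c *s v) = c *s \<pi> v" "{v. \<pi> v = 0} = \<Gamma>"
    and proj: "\<And>u. \<iota> ` (vec.span (\<Gamma> \<union> vec.span {u}) \<inter> \<Lambda>) = vec.span {\<pi> u}"
    using projection_coordinates[OF \<Gamma> \<Lambda> disj \<iota>] by auto
  obtain \<phi> where \<phi>: "\<phi> \<in> PGammaL" "\<phi> ` ((`) \<iota> ` projection \<Gamma> \<Lambda> (linear_set U)) = linear_set W"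
    using equiv unfolding pg_equivalent_def by auto
  obtain \<tau> f where f: "field_automorphism \<tau>" "semilinear \<tau> f" "bij f" "\<And>S. vec.subspace S \<Longrightarrow> \<phi> S = f ` S"
    using \<phi>(1) unfolding PGammaL_def by auto
  have set_eq: "(`) \<iota> ` projection \<Gamma> \<Lambda> (linear_set U) = (\<lambda>u. vec.span {\<pi> u}) ` (U - {0})"
  proof -
    have "projection \<Gamma> \<Lambda> (linear_set U) = (\<lambda>u. vec.span (\<Gamma> \<union> vec.span {u}) \<inter> \<Lambda>) ` (U - {0})"
      unfolding projection_def linear_set_def by auto
    then show ?thesis by (simp add: image_image proj)
  qed
  have \<phi>_span: "\<phi> (vec.span {v}) = vec.span {f v}" for v
    using f(4)[OF vec.subspace_span] semilinear_image_span_singleton[OF f(2) field_automorphism_surj[OF f(1)]]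
    by simp
  define \<omega> where "\<omega> v = f (\<pi> v)" for v
  have "(\<lambda>u. vec.span {\<omega> u}) ` (U - {0}) = linear_set W"
    using \<phi>(2) unfolding set_eq by (simp add: image_image \<phi>_span \<omega>_def)
  moreover have "f v = 0 \<longleftrightarrow> v = 0" for v
    using semilinear_zero[OF f(2)] bij_is_inj[OF f(3)] by (metis injD)
  then have "{v. \<omega> v = 0} = \<Gamma>" using \<pi>(3) by (simp add: \<omega>_def)
  ultimately show ?thesis
    using f(1,2) by (intro exI[of _ \<tau>] exI[of _ \<omega>]) (simp add: \<omega>_def \<pi>(1,2) semilinear_def)
qed

context finite_field_extension
begin

lemma Fq_span_diff:
  assumes "u \<in> Fq_span q B" "v \<in> Fq_span q (B :: ('a ^ 'r) set)"
  shows "u - v \<in> Fq_span q B"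
proof -
  obtain c where c: "c ` B \<subseteq> Fq q" "u = (\<Sum>b\<in>B. c b *s b)" using assms(1) unfolding Fq_span_def by blast
  obtain d where d: "d ` B \<subseteq> Fq q" "v = (\<Sum>b\<in>B. d b *s b)" using assms(2) unfolding Fq_span_def by blast
  have "u - v = (\<Sum>b\<in>B. (c b + - d b) *s b)"
    by (simp add: c d vec.scale_left_diff_distrib sum_subtractf)
  moreover have "(\<lambda>b. c b + - d b) ` B \<subseteq> Fq q"
    using c(1) d(1) by (intro image_subsetI Fq_add Fq_uminus) auto
  ultimately show ?thesis unfolding Fq_span_def mem_Collect_eq by (intro exI conjI)
qed

lemma funpow_frob:
  assumes "\<And>x::'a. \<theta> x = x ^ (q ^ r)"
  shows "(\<theta> ^^ i) x = x ^ (q ^ (r * i))"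
  by (induction i) (simp_all add: assms power_add mult.commute flip: power_mult)

text \<open>
  If \<open>d > 1\<close> divides both \<open>r\<close> and \<open>n\<close>, then \<open>\<theta> ^^ (n div d)\<close> is the identity, so \<open>f ^^ (n div d)\<close> is
  linear and scales all basis vectors equally: the order of \<open>\<sigma>\<close> would be at most \<open>n div d\<close>.
\<close>

lemma frob_exponent_coprime:
  fixes f :: "'a ^ 'r \<Rightarrow> 'a ^ 'r"
  assumes \<sigma>: "\<And>S. vec.subspace S \<Longrightarrow> \<sigma> S = f ` S" and f: "semilinear \<theta> f" and \<theta>: "field_automorphism \<theta>"
    and frob: "\<And>x. \<theta> x = x ^ (q ^ r)"
    and B: "vec.span B = UNIV" and fB: "\<forall>b\<in>B. f b = \<mu> *s b" "\<mu> \<noteq> 0"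
    and order: "collineation_order \<sigma> = n"
  shows "coprime r n"
proof (rule ccontr)
  assume "\<not> coprime r n"
  define d where "d = gcd r n"
  define k where "k = n div d"
  have d: "d > 1" "d dvd r" "d dvd n"
    using \<open>\<not> coprime r n\<close> n_pos by (auto simp: d_def coprime_iff_gcd_eq_1 nat_neq_iff)
  then have k: "n = d * k" "0 < k" "k < n" using n_pos by (auto simp: k_def dvd_imp_le div_greater_zero_iff)
  obtain r' where r': "r = d * r'" using d(2) by blast
  have id: "(\<theta> ^^ k) x = x" for x
  proof -
    have "r * k = n * r'" using k(1) r' by simp
    then show ?thesis using funpow_frob[OF frob, of k x] by (simp add: frob_mult_period)
  qed
  obtain \<nu> where \<nu>: "\<nu> \<noteq> 0" "\<forall>b\<in>B. (f ^^ k) b = \<nu> *s b" using funpow_eigen[OF f fB \<theta>] by blast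
  have fk: "(f ^^ k) v = \<nu> *s v" for v
  proof -
    have "v \<in> vec.span B" using B by simp
    then obtain c where c: "v = (\<Sum>b\<in>B. c b *s b)" using vec.span_finite[of B] by auto
    have "(f ^^ k) v = (\<Sum>b\<in>B. (\<theta> ^^ k) (c b) *s (f ^^ k) b)"
      unfolding c by (rule semilinear_sum[OF semilinear_funpow[OF f]])
    also have "\<dots> = (\<Sum>b\<in>B. \<nu> *s (c b *s b))" by (intro sum.cong) (simp_all add: id \<nu>(2) mult.commute)
    finally show ?thesis by (simp add: c vec.scale_sum_right)
  qed
  have "(\<sigma> ^^ k) P = P" if P: "P \<in> points" for P
  proof -
    obtain v where v: "P = vec.span {v}" using P unfolding points_def by blast
    have "(\<sigma> ^^ k) P = (f ^^ k) ` P"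
      using PGammaL_funpow_subspace[OF \<sigma> f field_automorphism_surj[OF \<theta>], of P k] v by simp
    also have "\<dots> = (\<lambda>v. \<nu> *s v) ` P" by (simp add: fk)
    also have "\<dots> = P"
    proof -
      have "surj (\<lambda>c. \<nu> * c)" using \<nu>(1) by (intro surjI[of _ "\<lambda>c. c / \<nu>"]) simp
      have "(\<lambda>v. \<nu> *s v) ` P = (\<lambda>c. c *s v) ` range (\<lambda>c. \<nu> * c)"
        by (simp add: v vec.span_singleton image_image)
      then show ?thesis by (simp only: \<open>surj _\<close> v vec.span_singleton)
    qed
    finally show ?thesis .
  qed
  then have "collineation_order \<sigma> \<le> k"
    unfolding collineation_order_def using k(2) by (intro Least_le) blast
  with order k(3) show False by simp
qed

text \<open>
  The left-hand side is an \<open>Fq q\<close>-linear function of \<open>x\<close>, so it vanishes once it does on a spanning family.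
\<close>

lemma relation_on_spanning_family:
  fixes X :: "'b \<Rightarrow> 'a"
  assumes span: "\<And>x. \<exists>c. (\<forall>j\<in>J. c j \<in> Fq q) \<and> x = (\<Sum>j\<in>J. c j * X j)"
    and rel: "\<And>j. j \<in> J \<Longrightarrow> (\<Sum>i\<in>I. c i * X j ^ (q ^ (r * i)) + d i * linearized q n e (X j) ^ (q ^ (r * i))) = 0"
  shows "(\<Sum>i\<in>I. c i * x ^ (q ^ (r * i)) + d i * linearized q n e x ^ (q ^ (r * i))) = 0"
proof -
  obtain a where a: "\<And>j. j \<in> J \<Longrightarrow> a j \<in> Fq q" "x = (\<Sum>j\<in>J. a j * X j)" using span by blast
  have lin: "linearized q n e x = (\<Sum>j\<in>J. a j * linearized q n e (X j))"
    unfolding a(2) linearized_sum using a(1) by (intro sum.cong) (simp_all add: linearized_scale)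
  have pow: "(\<Sum>j\<in>J. a j * y j) ^ (q ^ l) = (\<Sum>j\<in>J. a j * y j ^ (q ^ l))" for y l
    unfolding frob_sum using a(1) by (intro sum.cong) (simp_all add: power_mult_distrib Fq_power)
  have "(\<Sum>i\<in>I. c i * x ^ (q ^ (r * i)) + d i * linearized q n e x ^ (q ^ (r * i)))
      = (\<Sum>i\<in>I. \<Sum>j\<in>J. a j * (c i * X j ^ (q ^ (r * i)) + d i * linearized q n e (X j) ^ (q ^ (r * i))))"
    unfolding lin pow unfolding a(2) pow
    by (simp add: sum_distrib_left sum.distrib distrib_left mult_ac)
  also have "\<dots> = (\<Sum>j\<in>J. a j * (\<Sum>i\<in>I. c i * X j ^ (q ^ (r * i)) + d i * linearized q n e (X j) ^ (q ^ (r * i))))"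
    unfolding sum_distrib_left by (rule sum.swap)
  also have "\<dots> = 0" using rel by simp
  finally show ?thesis .
qed

text \<open>
  No point of the linear set has first coordinate \<open>0\<close>, hence \<open>u \<mapsto> \<omega> u $ 1\<close> is injective on the
  subgeometry, and by counting it is a bijection onto the field. The second coordinate is then a
  \<open>Fq q\<close>-linear function of the first, that is, a linearized polynomial with coefficients \<open>e\<close>.
\<close>

lemma subgeometry_polynomial:
  fixes B :: "('a ^ 'r) set" and \<omega> :: "'a ^ 'r \<Rightarrow> 'a ^ 2"
  assumes B: "vec.independent B" "card B = n"
    and \<tau>: "field_automorphism \<tau>" and add: "\<And>u v. \<omega> (u + v) = \<omega> u + \<omega> v"
    and scale: "\<And>c v. \<omega> (c *s v) = \<tau> c *s \<omega> v"
    and nz: "\<And>u. u \<in> Fq_span q B \<Longrightarrow> u \<noteq> 0 \<Longrightarrow> \<omega> u \<noteq> 0"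
    and L: "(\<lambda>u. vec.span {\<omega> u}) ` (Fq_span q B - {0}) = linear_set {vector [x, linearized q n a x] | x. True}"
  shows "(\<forall>x. \<exists>c. (\<forall>b\<in>B. c b \<in> Fq q) \<and> x = (\<Sum>b\<in>B. c b * \<omega> b $ 1)) \<and>
    (\<exists>e. (\<forall>b\<in>B. \<omega> b $ 2 = linearized q n e (\<omega> b $ 1)) \<and>
         slopes (linearized q n e) = slopes (linearized q n a))"
proof -
  define U where "U = Fq_span q B"
  have \<tau>_Fq: "\<tau> c \<in> Fq q" if "c \<in> Fq q" for c
    using that field_automorphism_power[OF \<tau>, of c q] by (simp add: Fq_def)
  have \<omega>0: "\<omega> 0 = 0" using scale[of 0 0] by (simp add: field_automorphism_zero[OF \<tau>])
  have \<omega>_sum: "\<omega> (\<Sum>b\<in>B. c b *s b) = (\<Sum>b\<in>B. \<tau> (c b) *s \<omega> b)" for c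
    by (induction B rule: infinite_finite_induct) (simp_all add: add scale \<omega>0)
  have \<omega>_sub: "\<omega> (u - v) = \<omega> u - \<omega> v" for u v
    using add[of "u - v" v] by (simp add: algebra_simps)
  have ratio: "\<omega> u $ 1 \<noteq> 0 \<and> \<omega> u $ 2 / \<omega> u $ 1 = linearized q n a x / x \<and> x \<noteq> 0"
    if "\<omega> u \<noteq> 0" "vec.span {\<omega> u} = vec.span {vector [x, linearized q n a x]}" for u x
  proof -
    have "\<omega> u \<in> vec.span {vector [x, linearized q n a x]}"
      using that(2) vec.span_base[of "\<omega> u" "{\<omega> u}"] by simp
    then obtain k where k: "\<omega> u = k *s vector [x, linearized q n a x]" by (auto simp: vec.span_singleton)
    then have comp: "\<omega> u $ 1 = k * x" "\<omega> u $ 2 = k * linearized q n a x" by simp_all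
    have "k \<noteq> 0" using k that(1) by auto
    moreover have "x \<noteq> 0"
    proof
      assume "x = 0"
      then have "\<omega> u $ i = 0" for i using comp exhaust_2[of i] by (auto simp: linearized_0)
      then show False using that(1) by (simp add: vec_eq_iff)
    qed
    ultimately show ?thesis by (simp add: comp)
  qed
  have L': "linear_set {vector [x, linearized q n a x] :: 'a ^ 2 | x. True}
      = (\<lambda>x. vec.span {vector [x, linearized q n a x]}) ` {x. (vector [x, linearized q n a x] :: 'a ^ 2) \<noteq> 0}"
    by (rule linear_set_parametrized)
  have from_U: "\<exists>x. \<omega> u $ 1 \<noteq> 0 \<and> \<omega> u $ 2 / \<omega> u $ 1 = linearized q n a x / x \<and> x \<noteq> 0"
    if u: "u \<in> U" "u \<noteq> 0" for u
  proof -
    have "vec.span {\<omega> u} \<in> (\<lambda>u. vec.span {\<omega> u}) ` (Fq_span q B - {0})"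
      using u unfolding U_def by (intro imageI) simp
    then obtain x where "vec.span {\<omega> u} = vec.span {vector [x, linearized q n a x]}"
      unfolding L L' by (rule imageE)
    from ratio[OF nz[OF u[unfolded U_def]] this] show ?thesis by (rule exI)
  qed
  have to_U: "\<exists>u\<in>U. \<omega> u $ 1 \<noteq> 0 \<and> \<omega> u $ 2 / \<omega> u $ 1 = linearized q n a x / x" if x: "x \<noteq> 0" for x
  proof -
    have "(vector [x, linearized q n a x] :: 'a ^ 2) $ 1 \<noteq> 0" using x by simp
    then have "(vector [x, linearized q n a x] :: 'a ^ 2) \<noteq> 0" by (metis zero_index)
    then have "vec.span {vector [x, linearized q n a x] :: 'a ^ 2} \<in> linear_set {vector [x, linearized q n a x] | x. True}"
      unfolding L' by (intro imageI CollectI)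
    then obtain u where u: "u \<in> U" "u \<noteq> 0" "vec.span {vector [x, linearized q n a x]} = vec.span {\<omega> u}"
      unfolding L[symmetric] U_def by (elim imageE DiffE) simp
    from ratio[OF nz[OF u(1,2)[unfolded U_def]] u(3)[symmetric]] show ?thesis using u(1) by blast
  qed
  have "inj_on (\<lambda>u. \<omega> u $ 1) U"
  proof (rule inj_onI, rule ccontr)
    fix u v assume uv: "u \<in> U" "v \<in> U" "\<omega> u $ 1 = \<omega> v $ 1" "u \<noteq> v"
    then have "u - v \<in> U" "u - v \<noteq> 0" using Fq_span_diff by (auto simp: U_def)
    then have "\<omega> (u - v) $ 1 \<noteq> 0" using from_U by blast
    then show False using uv(3) by (simp add: \<omega>_sub)
  qed
  then have "card ((\<lambda>u. \<omega> u $ 1) ` U) = card U" by (rule card_image)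
  moreover have "q ^ n \<le> card U" using card_Fq_span_ge[OF B(1)] B(2) by (simp add: U_def)
  ultimately have surj: "(\<lambda>u. \<omega> u $ 1) ` U = UNIV"
    using card_K by (intro card_seteq) simp_all
  have coords: "\<exists>c. (\<forall>b\<in>B. c b \<in> Fq q) \<and> \<omega> u = (\<Sum>b\<in>B. c b *s \<omega> b)" if u: "u \<in> U" for u
  proof -
    obtain c where "c ` B \<subseteq> Fq q" "u = (\<Sum>b\<in>B. c b *s b)" using u unfolding U_def Fq_span_def by blast
    then have "(\<forall>b\<in>B. \<tau> (c b) \<in> Fq q) \<and> \<omega> u = (\<Sum>b\<in>B. \<tau> (c b) *s \<omega> b)"
      using \<tau>_Fq by (auto simp: \<omega>_sum)
    then show ?thesis by (intro exI[of _ "\<lambda>b. \<tau> (c b)"])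
  qed
  have span: "\<exists>c. (\<forall>b\<in>B. c b \<in> Fq q) \<and> x = (\<Sum>b\<in>B. c b * \<omega> b $ 1)" for x
  proof -
    obtain u where u: "u \<in> U" "x = \<omega> u $ 1" using surj by blast
    then show ?thesis using coords[OF u(1)] by auto
  qed
  obtain e where e: "\<forall>b\<in>B. linearized q n e (\<omega> b $ 1) = \<omega> b $ 2"
    using linearized_interpolation[OF _ B(2) span, of "\<lambda>b. \<omega> b $ 2"] by auto
  have graph: "\<omega> u $ 2 = linearized q n e (\<omega> u $ 1)" if u: "u \<in> U" for u
  proof -
    obtain c where "\<forall>b\<in>B. c b \<in> Fq q" "\<omega> u = (\<Sum>b\<in>B. c b *s \<omega> b)" using coords[OF u] by blast
    then show ?thesis using e by (simp add: linearized_sum linearized_scale)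
  qed
  have "slopes (linearized q n e) = slopes (linearized q n a)"
  proof (intro equalityI subsetI)
    fix \<mu> assume "\<mu> \<in> slopes (linearized q n e)"
    then obtain x where x: "x \<noteq> 0" "\<mu> = linearized q n e x / x" unfolding slopes_def by auto
    obtain u where u: "u \<in> U" "x = \<omega> u $ 1" using surj by blast
    have "u \<noteq> 0" using u x \<omega>0 by auto
    from from_U[OF u(1) this] show "\<mu> \<in> slopes (linearized q n a)"
      using x u graph[OF u(1)] unfolding slopes_def by auto
  next
    fix \<mu> assume "\<mu> \<in> slopes (linearized q n a)"
    then obtain x where x: "x \<noteq> 0" "\<mu> = linearized q n a x / x" unfolding slopes_def by auto
    obtain u where u: "u \<in> U" "\<omega> u $ 1 \<noteq> 0" "\<omega> u $ 2 / \<omega> u $ 1 = linearized q n a x / x"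
      using to_U[OF x(1)] by blast
    then have "\<mu> = linearized q n e (\<omega> u $ 1) / \<omega> u $ 1" using x(2) graph[OF u(1)] by simp
    then show "\<mu> \<in> slopes (linearized q n e)"
      unfolding slopes_def using u(2) by (intro image_eqI[where x = "\<omega> u $ 1"]) simp_all
  qed
  moreover have "\<forall>b\<in>B. \<omega> b $ 2 = linearized q n e (\<omega> b $ 1)" using e by simp
  ultimately show ?thesis using span by (intro conjI allI exI[of _ e])
qed

end


section \<open>The intersection number\<close>

theorem proposition4p1:
  fixes q t s :: nat
    and m h :: "'a::{field,finite}"
    and \<Sigma> :: "('a ^ 'n) set set"
    and \<sigma> :: "('a ^ 'n) set \<Rightarrow> ('a ^ 'n) set"
    and \<Gamma> \<Lambda> :: "('a ^ 'n) set"
    and \<iota> :: "'a ^ 'n \<Rightarrow> 'a ^ 2"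
  assumes q: "primepow q" "odd q"
    and t: "t \<ge> 5"
    and s: "1 \<le> s" "s \<le> 2 * t - 1" "gcd s (2 * t) = 1"
    and field: "CARD('a) = q ^ (2 * t)"
    and dimension: "CARD('n) = 2 * t"
    and adm: "admissible q t s m h"
    and \<Sigma>: "canonical_subgeometry q \<Sigma>"
    and \<sigma>: "\<sigma> \<in> PGammaL" "collineation_order \<sigma> = 2 * t" "\<forall>P\<in>\<Sigma>. \<sigma> P = P"
    and \<Gamma>: "proj_subspace (2 * int t - 3) \<Gamma>"
    and \<Lambda>: "proj_subspace 1 \<Lambda>"
    and disjoint: "\<forall>P\<in>\<Sigma>. \<not> P \<subseteq> \<Gamma>" "\<Gamma> \<inter> \<Lambda> = {0}"
    and \<iota>: "line_coordinates \<Lambda> \<iota>"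
    and equiv: "pg_equivalent ((`) \<iota> ` projection \<Gamma> \<Lambda> \<Sigma>) (L_psi q t m h s)"
  shows "intn \<sigma> \<Gamma> \<ge> 3"
proof -
  interpret finite_field_extension q "2 * t" "TYPE('a)"
    using q field by unfold_locales
  have cop: "coprime s (2 * t)" using s(3) by (simp add: coprime_iff_gcd_eq_1)
  have "m \<noteq> 0" "Nm q t h = 1 \<or> Nm q t h = - 1" using adm by (auto simp: admissible_def)
  moreover from this(2) have "h \<noteq> 0" by (auto simp: Nm_def)
  ultimately obtain a where psi: "\<And>x. psi q t m h s x = linearized q (2 * t) a x"
    and supp_a: "\<And>i. i < 2 * t \<Longrightarrow> a i \<noteq> 0 \<longleftrightarrow> sym_residue t s i"
    using psi_coefficients[OF t s(1,2) cop frob_mod, of m h] by blast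

  obtain B where B: "card B = 2 * t" "vec.independent B" "vec.span B = UNIV" "\<Sigma> = linear_set (Fq_span q B)"
    using canonical_subgeometry_basis[OF \<Sigma>] dimension by auto
  have point: "vec.span {u} \<in> \<Sigma>" if "u \<in> Fq_span q B" "u \<noteq> 0" for u
    using that unfolding B(4) linear_set_def by blast
  have sG: "vec.subspace \<Gamma>" and dG: "pdim \<Gamma> = 2 * int t - 3" using \<Gamma> by (auto simp: proj_subspace_def)

  obtain \<theta> f where f: "field_automorphism \<theta>" "semilinear \<theta> f" "bij f"
    and \<sigma>_f: "\<And>S. vec.subspace S \<Longrightarrow> \<sigma> S = f ` S"
    using \<sigma>(1) unfolding PGammaL_def by auto
  have fix_pts: "f ` vec.span {u} = vec.span {u}" if "u \<in> Fq_span q B" "u \<noteq> 0" for u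
    using point[OF that] \<sigma>(3) \<sigma>_f[OF vec.subspace_span, of "{u}"] by simp
  have "card B \<ge> 2" "q > 0" using B(1) t q_ge_2 by simp_all
  note fixing = semilinear_fixing_subgeometry[OF f(2) bij_is_inj[OF f(3)] f(1) B(2) this fix_pts]
  obtain \<mu> where \<mu>: "\<mu> \<noteq> 0" "\<forall>b\<in>B. f b = \<mu> *s b" using fixing(1) by blast

  have L: "linear_set {vector [x, linearized q (2 * t) a x] | x. True} = L_psi q t m h s"
    by (simp add: L_psi_def psi)
  have \<Gamma>': "proj_subspace (int (2 * t) - 3) \<Gamma>" using \<Gamma> by simp
  obtain \<tau> and \<omega> :: "'a ^ 'n \<Rightarrow> 'a ^ 2" where \<tau>: "field_automorphism \<tau>"
    and \<omega>': "\<forall>u v. \<omega> (u + v) = \<omega> u + \<omega> v" "\<forall>c v. \<omega> (c *s v) = \<tau> c *s \<omega> v" "{v. \<omega> v = 0} = \<Gamma>"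
    and pts: "(\<lambda>u. vec.span {\<omega> u}) ` (Fq_span q B - {0}) = linear_set {vector [x, linearized q (2 * t) a x] | x. True}"
    using vertex_coordinates[OF \<Gamma>'[folded dimension] \<Lambda> disjoint(2) \<iota> equiv[unfolded B(4) L[symmetric]]]
    by (elim exE conjE)
  note \<omega> = \<omega>'(1,2)[rule_format] \<omega>'(3)
  have nz: "\<omega> u \<noteq> 0" if "u \<in> Fq_span q B" "u \<noteq> 0" for u
  proof
    assume "\<omega> u = 0"
    then have "{u} \<subseteq> \<Gamma>" using \<omega>(3) by auto
    then have "vec.span {u} \<subseteq> \<Gamma>" using sG by (rule vec.span_minimal)
    with point[OF that] disjoint(1) show False by blast
  qed
  obtain e where span: "\<And>x. \<exists>c. (\<forall>b\<in>B. c b \<in> Fq q) \<and> x = (\<Sum>b\<in>B. c b * \<omega> b $ 1)"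
    and graph: "\<And>b. b \<in> B \<Longrightarrow> \<omega> b $ 2 = linearized q (2 * t) e (\<omega> b $ 1)"
    and slopes: "slopes (linearized q (2 * t) e) = slopes (linearized q (2 * t) a)"
    using subgeometry_polynomial[OF B(2,1) \<tau> \<omega>(1,2) nz pts] by blast

  have finB: "finite B" by simp
  obtain r where \<theta>: "\<And>x. \<theta> x = x ^ (q ^ r)"
    using Fq_automorphism_is_frob_power[OF f(1) fixing(2) finB B(1) span] by blast
  have r: "coprime r (2 * t)"
    by (rule frob_exponent_coprime[OF \<sigma>_f f(2,1) \<theta> B(3) \<mu>(2,1) \<sigma>(2)])

  have pair: "e k \<noteq> 0 \<and> e (2 * t - k) \<noteq> 0 \<longleftrightarrow> sym_residue t s k" if k: "0 < k" "k < 2 * t" for k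
  proof -
    have "e k * e (2 * t - k) ^ (q ^ k) = a k * a (2 * t - k) ^ (q ^ k)"
      by (rule slopes_eq_imp_coeff_products_eq[OF slopes k])
    moreover have "x \<noteq> 0 \<and> y \<noteq> 0 \<longleftrightarrow> x * y ^ (q ^ k) \<noteq> 0" for x y :: 'a using q_ge_2 by simp
    ultimately have "e k \<noteq> 0 \<and> e (2 * t - k) \<noteq> 0 \<longleftrightarrow> a k \<noteq> 0 \<and> a (2 * t - k) \<noteq> 0" by metis
    also have "\<dots> \<longleftrightarrow> sym_residue t s k"
      using supp_a[of k] supp_a[of "2 * t - k"] sym_residue_reflect[of k t s] k by simp
    finally show ?thesis .
  qed

  \<comment> \<open>Untwisting \<open>\<omega>\<close> by \<open>\<kappa>\<close> makes it linear and keeps its kernel. The relations are transported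
    back by \<open>\<tau>\<close>, which commutes with the Frobenius power \<open>\<theta>\<close>.\<close>
  define \<kappa> where "\<kappa> = inv \<tau>"
  have \<kappa>: "field_automorphism \<kappa>" unfolding \<kappa>_def by (rule field_automorphism_inv[OF \<tau>])
  have \<tau>\<kappa>: "\<tau> (\<kappa> x) = x" "\<kappa> (\<tau> x) = x" for x
    unfolding \<kappa>_def using \<tau> by (simp_all add: surj_f_inv_f field_automorphism_surj field_automorphism_inj)
  define \<pi> :: "'a ^ 'n \<Rightarrow> 'a ^ 2" where "\<pi> v = (\<chi> k. \<kappa> (\<omega> v $ k))" for v
  have \<pi>: "\<pi> (u + v) = \<pi> u + \<pi> v" "\<pi> (c *s v) = c *s \<pi> v" for u v c
    by (simp_all add: \<pi>_def vec_eq_iff \<omega> field_automorphism_add[OF \<kappa>] field_automorphism_mult[OF \<kappa>] \<tau>\<kappa>)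
  have "{v. \<pi> v = 0} = \<Gamma>"
    using \<omega>(3) by (auto simp: \<pi>_def vec_eq_iff field_automorphism_eq_zero_iff[OF \<kappa>])
  note \<Gamma>_\<pi> = this
  have dim_le: "pdim (\<Inter>i\<in>{..\<gamma>}. (\<sigma> ^^ i) \<Gamma>) \<le> pdim \<Gamma> - 2 * int \<gamma>" if \<gamma>: "\<gamma> \<le> 2" for \<gamma>
  proof -
    have indep: "C i k = 0"
      if C: "\<forall>b\<in>B. (\<Sum>i\<le>\<gamma>. \<Sum>k\<in>UNIV. C i k * (\<theta> ^^ i) (\<pi> b $ k)) = 0" and i: "i \<le> \<gamma>" for C i and k :: 2
    proof -
      \<comment> \<open>Padding with zeros treats \<open>\<gamma> = 1\<close> and \<open>\<gamma> = 2\<close> alike.\<close>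
      define c where "c i = (if i \<le> \<gamma> then \<tau> (C i 1) else 0)" for i
      define d where "d i = (if i \<le> \<gamma> then \<tau> (C i 2) else 0)" for i
      have "(\<Sum>i<3. c i * x ^ (q ^ (r * i)) + d i * linearized q (2 * t) e x ^ (q ^ (r * i))) = 0" for x
      proof (rule relation_on_spanning_family[OF span])
        fix b assume b: "b \<in> B"
        have \<tau>_pow: "\<tau> ((\<theta> ^^ i) (\<kappa> y)) = y ^ (q ^ (r * i))" for i y
          by (simp add: funpow_frob[OF \<theta>] field_automorphism_power[OF \<tau>] \<tau>\<kappa>)
        have "0 = \<tau> (\<Sum>i\<le>\<gamma>. \<Sum>k\<in>UNIV. C i k * (\<theta> ^^ i) (\<pi> b $ k))"
          using C b by (simp add: field_automorphism_zero[OF \<tau>])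
        also have "\<dots> = (\<Sum>i\<le>\<gamma>. \<tau> (C i 1) * (\<omega> b $ 1) ^ (q ^ (r * i)) + \<tau> (C i 2) * (\<omega> b $ 2) ^ (q ^ (r * i)))"
          by (simp add: sum_2 \<pi>_def field_automorphism_sum[OF \<tau>] field_automorphism_add[OF \<tau>]
                field_automorphism_mult[OF \<tau>] \<tau>_pow)
        also have "\<dots> = (\<Sum>i\<le>\<gamma>. c i * (\<omega> b $ 1) ^ (q ^ (r * i)) + d i * linearized q (2 * t) e (\<omega> b $ 1) ^ (q ^ (r * i)))"
          by (intro sum.cong) (simp_all add: c_def d_def graph[OF b])
        also have "\<dots> = (\<Sum>i<3. c i * (\<omega> b $ 1) ^ (q ^ (r * i)) + d i * linearized q (2 * t) e (\<omega> b $ 1) ^ (q ^ (r * i)))"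
          by (rule sum.mono_neutral_left) (use \<gamma> in \<open>auto simp: c_def d_def\<close>)
        finally show "(\<Sum>i<3. c i * (\<omega> b $ 1) ^ (q ^ (r * i)) + d i * linearized q (2 * t) e (\<omega> b $ 1) ^ (q ^ (r * i))) = 0"
          by simp
      qed
      from no_short_relation[OF t refl r cop pair this, of i] i \<gamma>
      have "\<tau> (C i 1) = 0" "\<tau> (C i 2) = 0" by (simp_all add: c_def d_def)
      then show ?thesis using exhaust_2[of k] by (auto simp: field_automorphism_eq_zero_iff[OF \<tau>])
    qed
    have "(\<Inter>i\<in>{..\<gamma>}. (\<sigma> ^^ i) \<Gamma>) = (\<Inter>i\<in>{..\<gamma>}. (f ^^ i) ` {v. \<pi> v = 0})"
      using PGammaL_funpow_subspace[OF \<sigma>_f f(2) field_automorphism_surj[OF f(1)] sG] unfolding \<Gamma>_\<pi> by simp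
    moreover have "vec.dim (\<Inter>i\<in>{..\<gamma>}. (f ^^ i) ` {v. \<pi> v = 0}) + 2 * (\<gamma> + 1) \<le> CARD('n)"
      by (rule dim_shifted_intersection[OF \<pi> B(2,3) f(2,1) \<mu>(2,1)]) (rule indep)
    ultimately show ?thesis using dG dimension by (simp add: pdim_def)
  qed
  define P where "P \<gamma> \<longleftrightarrow> \<gamma> > 0 \<and> pdim (\<Inter>i\<in>{..\<gamma>}. (\<sigma> ^^ i) \<Gamma>) > pdim \<Gamma> - 2 * int \<gamma>" for \<gamma>
  \<comment> \<open>At \<open>\<gamma> = t\<close> the bound \<open>pdim \<Gamma> - 2 * \<gamma>\<close> is \<open>-3\<close>, below every dimension, so the least \<open>\<gamma>\<close> exists.\<close>
  have "P t" using t by (simp add: P_def dG) (simp add: pdim_def)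
  then have "P (intn \<sigma> \<Gamma>)" unfolding intn_def P_def[symmetric] by (rule LeastI)
  then have "\<not> intn \<sigma> \<Gamma> \<le> 2" unfolding P_def using dim_le[of "intn \<sigma> \<Gamma>"] by linarith
  then show ?thesis by simp
qed

end
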